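(* Let $\alpha=(\alpha_n)_{n\in\mathbb N}$ be a positive, strictly increasing sequence with $\alpha_n\to\infty$, and let $\mathsf C\in\mathcal L(E_\alpha)$ be the Cesàro operator. The sequence of iterates $\{\mathsf C^m\}_{m\in\mathbb N}$ converges in $\mathcal L_b(E_\alpha)$ to the projection onto $\mathrm{span}\{\mathbf 1\}$ along $\overline{(I-\mathsf C)(E_\alpha)}$.
   Context: $\mathbb N=\{1,2,3,\dots\}$. For a strictly positive sequence $w$ on $\mathbb N$, $c_0(w)=\{x\in\mathbb C^{\mathbb N}: \lim_{n\to\infty} w(n)|x_n|=0\}$, a Banach space with norm $\sup_n w(n)|x_n|$. Given $\alpha$, fix a strictly increasing sequence $(s_k)_{k\in\mathbb N}\subset(1,\infty)$ with $s_k\to\infty$ and put $v_k(n):=s_k^{-\alpha_n}$. Define $E_\alpha:=\mathrm{ind}_k\, c_0(v_k)$, i.e. $E_\alpha=\bigcup_k c_0(v_k)\subseteq\mathbb C^{\mathbb N}$ endowed with the finest locally convex Hausdorff topology making all inclusions $c_0(v_k)\hookrightarrow E_\alpha$ continuous; $E_\alpha$ does not depend on the choice of $(s_k)$. The Cesàro operator is $\mathsf Cx=\left(\frac{x_1+\dots+x_n}{n}\right)_{n\in\mathbb N}$, and it belongs to $\mathcal L(E_\alpha)$ (continuous linear operators from $E_\alpha$ into itself). $\mathbf 1=(1)_{n\in\mathbb N}$ is the constant sequence, and $E_\alpha=\mathrm{span}\{\mathbf 1\}\oplus\overline{(I-\mathsf C)(E_\alpha)}$, closure in $E_\alpha$.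 $\mathcal L_b(X)$ is $\mathcal L(X)$ with the topology of uniform convergence on bounded subsets of $X$. *)

theory Defs
  imports "HOL-Analysis.Analysis" "HOL-Library.Function_Algebras"
begin

text \<open>
  Sequences are mathematically indexed by 1, 2, 3, and so on; here the index \<open>n :: nat\<close>
  stands for the mathematical index \<open>n + 1\<close>, throughout (for \<open>\<alpha>\<close>, for \<open>s\<close>, for the weights and for the elements of the sequence spaces).
\<close>

type_synonym cseq = "nat \<Rightarrow> complex"

definition cscale :: "complex \<Rightarrow> cseq \<Rightarrow> cseq"  (infixr \<open>*\<^sub>c\<close> 75)
  where "c *\<^sub>c x = (\<lambda>n. c * x n)"

lemma cscale_apply [simp]: "(c *\<^sub>c x) n = c * x n"
  by (simp add: cscale_def)

global_interpretation cseq: vector_space cscale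
  defines cseq_span = cseq.span and cseq_subspace = cseq.subspace
  by unfold_locales (auto simp: fun_eq_iff algebra_simps)


section \<open>Locally convex topologies and inductive limits\<close>

definition convex_cseq :: "cseq set \<Rightarrow> bool"
  where "convex_cseq A \<longleftrightarrow>
    (\<forall>x\<in>A. \<forall>y\<in>A. \<forall>t\<in>{0..1::real}. of_real (1 - t) *\<^sub>c x + of_real t *\<^sub>c y \<in> A)"

definition lcHs :: "cseq topology \<Rightarrow> bool"
  where "lcHs T \<longleftrightarrow>
    cseq_subspace (topspace T) \<and>
    continuous_map (prod_topology T T) T (\<lambda>(x, y). x + y) \<and>
    continuous_map (prod_topology euclidean T) T (\<lambda>(c, x). c *\<^sub>c x) \<and>
    (\<forall>U. openin T U \<and> 0 \<in> U \<longrightarrow> (\<exists>V. openin T V \<and> 0 \<in> V \<and> convex_cseq V \<and> V \<subseteq> U)) \<and>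
    Hausdorff_space T"

text \<open>
  \<open>S k\<close> is the \<open>k\<close>-th step, a topology whose \<open>topspace\<close> is the step as a set.
\<close>

definition lcHs_on_steps :: "(nat \<Rightarrow> cseq topology) \<Rightarrow> cseq topology \<Rightarrow> bool"
  where "lcHs_on_steps S T \<longleftrightarrow>
    topspace T = (\<Union>k. topspace (S k)) \<and> lcHs T \<and> (\<forall>k. continuous_map (S k) T (\<lambda>x. x))"

definition is_ind_lim :: "(nat \<Rightarrow> cseq topology) \<Rightarrow> cseq topology \<Rightarrow> bool"
  where "is_ind_lim S T \<longleftrightarrow>
    lcHs_on_steps S T \<and> (\<forall>T' U. lcHs_on_steps S T' \<and> openin T' U \<longrightarrow> openin T U)"

definition ind_lim :: "(nat \<Rightarrow> cseq topology) \<Rightarrow> cseq topology"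
  where "ind_lim S = (THE T. is_ind_lim S T)"

lemma is_ind_lim_unique: "is_ind_lim S T \<Longrightarrow> is_ind_lim S T' \<Longrightarrow> T = T'"
  unfolding is_ind_lim_def topology_eq by blast

lemma ind_lim_eqI: "is_ind_lim S T \<Longrightarrow> ind_lim S = T"
  unfolding ind_lim_def by (rule the_equality) (auto dest: is_ind_lim_unique)

lemma continuous_map_finer:
  assumes "continuous_map X T f" "continuous_map X' X (\<lambda>x. x)"
  shows "continuous_map X' T f"
  using continuous_map_compose[OF assms(2,1)] by (simp add: o_def)

text \<open>The finest topology exists as soon as there is one admissible topology at all.\<close>

lemma is_ind_lim_ind_lim:
  assumes T0: "lcHs_on_steps S T0"
  shows "is_ind_lim S (ind_lim S)"
proof -
  define F where "F = {U. \<exists>T. lcHs_on_steps S T \<and> openin T U}"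
  define J where "J = topology_generated_by F"
  let ?E = "\<Union>k. topspace (S k)"
  have UF: "\<Union>F = ?E"
  proof
    show "\<Union>F \<subseteq> ?E"
    proof
      fix x assume "x \<in> \<Union>F"
      then obtain T U where "lcHs_on_steps S T" "openin T U" "x \<in> U" by (auto simp: F_def)
      then show "x \<in> ?E" using openin_subset unfolding lcHs_on_steps_def by blast
    qed
    have "?E \<in> F"
      unfolding F_def using T0 lcHs_on_steps_def openin_topspace by (metis (mono_tags) mem_Collect_eq)
    then show "?E \<subseteq> \<Union>F" by blast
  qed
  have topJ: "topspace J = ?E" by (simp add: J_def UF)
  have finest: "openin J U" if "lcHs_on_steps S T" "openin T U" for T U
    unfolding J_def using that by (intro topology_generated_by_Basis) (auto simp: F_def)
  have finer: "continuous_map J T (\<lambda>x. x)" if "lcHs_on_steps S T" for T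
  proof -
    have "{x \<in> topspace J. x \<in> U} = U" if "openin T U" for U
      using that \<open>lcHs_on_steps S T\<close> topJ openin_subset unfolding lcHs_on_steps_def by fastforce
    then show ?thesis
      using that finest topJ unfolding continuous_map_def lcHs_on_steps_def by auto
  qed
  have into: "continuous_map X J f" if "\<And>T. lcHs_on_steps S T \<Longrightarrow> continuous_map X T f" for X f
    unfolding J_def
  proof (rule continuous_on_generated_topo)
    fix U assume "U \<in> F"
    then obtain T where T: "lcHs_on_steps S T" "openin T U" by (auto simp: F_def)
    have "f -` U \<inter> topspace X = {x \<in> topspace X. f x \<in> U}" by auto
    then show "openin X (f -` U \<inter> topspace X)"
      using that[OF T(1)] T(2) by (simp add: continuous_map_def)
  next
    show "f ` topspace X \<subseteq> \<Union>F"
      using that[OF T0] T0 UF unfolding continuous_map_def lcHs_on_steps_def by auto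
  qed
  have "lcHs J"
    unfolding lcHs_def
  proof (intro conjI allI impI)
    show "cseq_subspace (topspace J)"
      using T0 topJ unfolding lcHs_on_steps_def lcHs_def by metis
    show "continuous_map (prod_topology J J) J (\<lambda>(x, y). x + y)"
    proof (rule into)
      fix T assume T: "lcHs_on_steps S T"
      have "continuous_map (prod_topology J J) (prod_topology T T) (\<lambda>z. (fst z, snd z))"
        by (intro continuous_map_pairedI continuous_map_compose[OF continuous_map_fst finer[OF T], unfolded o_def]
             continuous_map_compose[OF continuous_map_snd finer[OF T], unfolded o_def])
      then show "continuous_map (prod_topology J J) T (\<lambda>(x, y). x + y)"
        using T unfolding lcHs_on_steps_def lcHs_def by (auto intro: continuous_map_finer)
    qed
    show "continuous_map (prod_topology euclidean J) J (\<lambda>(c, x). c *\<^sub>c x)"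
    proof (rule into)
      fix T assume T: "lcHs_on_steps S T"
      have "continuous_map (prod_topology euclidean J) (prod_topology euclidean T) (\<lambda>z. (fst z, snd z))"
        by (intro continuous_map_pairedI continuous_map_fst
             continuous_map_compose[OF continuous_map_snd finer[OF T], unfolded o_def])
      then show "continuous_map (prod_topology euclidean J) T (\<lambda>(c, x). c *\<^sub>c x)"
        using T unfolding lcHs_on_steps_def lcHs_def by (auto intro: continuous_map_finer)
    qed
    show "Hausdorff_space J"
      unfolding Hausdorff_space_def
    proof (intro allI impI)
      fix x y assume xy: "x \<in> topspace J \<and> y \<in> topspace J \<and> x \<noteq> y"
      have "Hausdorff_space T0" "topspace T0 = topspace J"
        using T0 topJ by (auto simp: lcHs_on_steps_def lcHs_def)
      with xy obtain U V where "openin T0 U" "openin T0 V" "x \<in> U" "y \<in> V" "disjnt U V"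
        unfolding Hausdorff_space_def by metis
      then show "\<exists>U V. openin J U \<and> openin J V \<and> x \<in> U \<and> y \<in> V \<and> disjnt U V"
        using finest[OF T0] by blast
    qed
  next
    fix U :: "cseq set" assume U: "openin J U \<and> 0 \<in> U"
    then have "generate_topology_on F U"
      unfolding J_def by (simp add: openin_topology_generated_by_iff)
    then have "0 \<in> U \<longrightarrow> (\<exists>V. openin J V \<and> 0 \<in> V \<and> convex_cseq V \<and> V \<subseteq> U)"
    proof induction
      case Empty
      then show ?case by simp
    next
      case (Int a b)
      show ?case
      proof
        assume "0 \<in> a \<inter> b"
        then obtain V W where VW: "openin J V" "0 \<in> V" "convex_cseq V" "V \<subseteq> a"
            "openin J W" "0 \<in> W" "convex_cseq W" "W \<subseteq> b"
          using Int.IH by blast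
        have "convex_cseq (V \<inter> W)"
          using VW(3,7) unfolding convex_cseq_def by simp
        then show "\<exists>V. openin J V \<and> 0 \<in> V \<and> convex_cseq V \<and> V \<subseteq> a \<inter> b"
          using VW by (intro exI[of _ "V \<inter> W"]) auto
      qed
    next
      case (UN K)
      then show ?case by (meson Union_iff Union_upper order_trans)
    next
      case (Basis s)
      then obtain T where T: "lcHs_on_steps S T" "openin T s" by (auto simp: F_def)
      then have "\<exists>V. openin T V \<and> 0 \<in> V \<and> convex_cseq V \<and> V \<subseteq> s" if "0 \<in> s"
        using that by (simp add: lcHs_on_steps_def lcHs_def)
      then show ?case
        using finest[OF T(1)] by blast
    qed
    with U show "\<exists>V. openin J V \<and> 0 \<in> V \<and> convex_cseq V \<and> V \<subseteq> U" by blast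
  qed
  moreover have "continuous_map (S k) J (\<lambda>x. x)" for k
    by (rule into) (simp add: lcHs_on_steps_def)
  ultimately have "is_ind_lim S J"
    using topJ finest unfolding is_ind_lim_def lcHs_on_steps_def by blast
  then show ?thesis using ind_lim_eqI by metis
qed


section \<open>The weighted null sequence spaces and the space \<open>E\<^sub>\<alpha>\<close>\<close>

definition c0 :: "(nat \<Rightarrow> real) \<Rightarrow> cseq set"
  where "c0 w = {x. (\<lambda>n. w n * norm (x n)) \<longlonglongrightarrow> 0}"

text \<open>
  The value \<open>0\<close> off \<open>c0 w\<close> is a dummy: \<open>Metric_space\<close> asks for a distance function that is
  nonnegative and symmetric on the whole type.
\<close>

definition c0_norm :: "(nat \<Rightarrow> real) \<Rightarrow> cseq \<Rightarrow> real"
  where "c0_norm w x = (if x \<in> c0 w then SUP n. w n * norm (x n) else 0)"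

definition c0_topology :: "(nat \<Rightarrow> real) \<Rightarrow> cseq topology"
  where "c0_topology w = Metric_space.mtopology (c0 w) (\<lambda>x y. c0_norm w (x - y))"

definition E_weight :: "(nat \<Rightarrow> real) \<Rightarrow> (nat \<Rightarrow> real) \<Rightarrow> nat \<Rightarrow> nat \<Rightarrow> real"
  where "E_weight \<alpha> s k n = s k powr (- \<alpha> n)"

definition E_topology :: "(nat \<Rightarrow> real) \<Rightarrow> (nat \<Rightarrow> real) \<Rightarrow> cseq topology"
  where "E_topology \<alpha> s = ind_lim (\<lambda>k. c0_topology (E_weight \<alpha> s k))"

lemma c0_bdd_above:
  assumes "x \<in> c0 w"
  shows "bdd_above (range (\<lambda>n. w n * norm (x n)))"
proof -
  have "Bseq (\<lambda>n. w n * norm (x n))"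
    using assms by (auto simp: c0_def intro: convergent_imp_Bseq convergentI)
  then show ?thesis by (rule Bseq_bdd_above)
qed

lemma c0_norm_upper: "x \<in> c0 w \<Longrightarrow> w n * norm (x n) \<le> c0_norm w x"
  by (auto simp: c0_norm_def intro: cSUP_upper c0_bdd_above)

lemma c0_norm_least:
  assumes "x \<in> c0 w" "\<And>n. w n * norm (x n) \<le> b"
  shows "c0_norm w x \<le> b"
  using assms by (auto simp: c0_norm_def intro: cSUP_least)

lemma c0_subspace:
  assumes w: "\<And>n. 0 < w n"
  shows "cseq_subspace (c0 w)"
  unfolding cseq.subspace_def
proof (intro conjI ballI allI)
  show "0 \<in> c0 w" by (simp add: c0_def)
next
  fix x y assume "x \<in> c0 w" "y \<in> c0 w"
  then have "(\<lambda>n. w n * norm (x n) + w n * norm (y n)) \<longlonglongrightarrow> 0 + 0"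
    unfolding c0_def by (intro tendsto_add) auto
  then have lim: "(\<lambda>n. w n * norm (x n) + w n * norm (y n)) \<longlonglongrightarrow> 0" by simp
  have le: "w n * norm (x n + y n) \<le> w n * norm (x n) + w n * norm (y n)" for n
    using w[of n] norm_triangle_ineq[of "x n" "y n"]
    by (simp flip: distrib_left add: mult_left_mono)
  have "(\<lambda>n. w n * norm ((x + y) n)) \<longlonglongrightarrow> 0"
    by (rule tendsto_sandwich[OF _ _ tendsto_const lim]) (use w le in \<open>auto simp: less_imp_le\<close>)
  then show "x + y \<in> c0 w" by (simp add: c0_def)
next
  fix c :: complex and x assume "x \<in> c0 w"
  then have "(\<lambda>n. norm c * (w n * norm (x n))) \<longlonglongrightarrow> norm c * 0"
    unfolding c0_def by (intro tendsto_mult tendsto_const) auto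
  then show "c *\<^sub>c x \<in> c0 w" by (simp add: c0_def norm_mult algebra_simps)
qed

lemma Metric_space_c0:
  assumes w: "\<And>n. 0 < w n"
  shows "Metric_space (c0 w) (\<lambda>x y. c0_norm w (x - y))"
proof -
  have sub: "cseq_subspace (c0 w)" by (rule c0_subspace) (rule w)
  show ?thesis
  proof
    fix x y
    have "0 \<le> c0_norm w z" for z
    proof (cases "z \<in> c0 w")
      case True
      have "0 \<le> w 0 * norm (z 0)" using w[of 0] by simp
      also have "\<dots> \<le> c0_norm w z" by (rule c0_norm_upper[OF True])
      finally show ?thesis .
    qed (simp add: c0_norm_def)
    then show "0 \<le> c0_norm w (x - y)" .
    show "c0_norm w (x - y) = c0_norm w (y - x)"
      by (simp add: c0_norm_def c0_def norm_minus_commute)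
  next
    fix x y assume "x \<in> c0 w" "y \<in> c0 w"
    then have mem: "x - y \<in> c0 w"
      using cseq.subspace_diff[OF sub] by blast
    show "c0_norm w (x - y) = 0 \<longleftrightarrow> x = y"
    proof
      assume 0: "c0_norm w (x - y) = 0"
      have "x n = y n" for n
        using c0_norm_upper[OF mem, of n] w[of n] 0 by (simp add: mult_le_0_iff)
      then show "x = y" by auto
    next
      assume "x = y"
      then show "c0_norm w (x - y) = 0"
        by (simp add: c0_norm_def)
    qed
  next
    fix x y z assume xyz: "x \<in> c0 w" "y \<in> c0 w" "z \<in> c0 w"
    then have mem: "x - y \<in> c0 w" "y - z \<in> c0 w" "x - z \<in> c0 w"
      using cseq.subspace_diff[OF sub] by blast+
    show "c0_norm w (x - z) \<le> c0_norm w (x - y) + c0_norm w (y - z)"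
    proof (rule c0_norm_least[OF mem(3)])
      fix n
      have "w n * norm ((x - z) n) \<le> w n * (norm ((x - y) n) + norm ((y - z) n))"
        using w[of n] norm_triangle_ineq[of "x n - y n" "y n - z n"] by (intro mult_left_mono) auto
      also have "\<dots> \<le> c0_norm w (x - y) + c0_norm w (y - z)"
        using c0_norm_upper[OF mem(1), of n] c0_norm_upper[OF mem(2), of n] by (simp add: distrib_left)
      finally show "w n * norm ((x - z) n) \<le> c0_norm w (x - y) + c0_norm w (y - z)" .
    qed
  qed
qed

lemma topspace_c0_topology:
  "(\<And>n. 0 < w n) \<Longrightarrow> topspace (c0_topology w) = c0 w"
  unfolding c0_topology_def by (intro Metric_space.topspace_mtopology Metric_space_c0)

lemma c0_antimono:
  assumes "\<And>n. 0 < w' n" "\<And>n. w' n \<le> w n"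
  shows "c0 w \<subseteq> c0 w'"
proof
  fix x assume "x \<in> c0 w"
  then have lim: "(\<lambda>n. w n * norm (x n)) \<longlonglongrightarrow> 0" by (simp add: c0_def)
  have "(\<lambda>n. w' n * norm (x n)) \<longlonglongrightarrow> 0"
    by (rule tendsto_sandwich[OF _ _ tendsto_const lim])
       (use assms in \<open>auto simp: less_imp_le mult_right_mono\<close>)
  then show "x \<in> c0 w'" by (simp add: c0_def)
qed

lemma euclidean_cseq: "(euclidean :: cseq topology) = product_topology (\<lambda>_. euclidean) UNIV"
  by (simp add: euclidean_product_topology)

lemma lcHs_coordinatewise:
  assumes E: "cseq_subspace E"
  shows "lcHs (subtopology euclidean E)"
  unfolding lcHs_def
proof (intro conjI allI impI)
  let ?T = "subtopology (euclidean :: cseq topology) E"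
  have coord: "continuous_map ?T euclidean (\<lambda>x. x n)" for n
    by (intro continuous_map_from_subtopology) simp
  have into: "continuous_map X ?T f"
    if "\<And>n. continuous_map X euclidean (\<lambda>z. f z n)" "\<And>z. z \<in> topspace X \<Longrightarrow> f z \<in> E" for X :: "'a topology" and f
  proof -
    have "continuous_map X euclidean f"
      unfolding euclidean_cseq continuous_map_componentwise_UNIV using that(1) by blast
    then show ?thesis using that(2) by (auto simp: continuous_map_in_subtopology)
  qed
  show "cseq_subspace (topspace ?T)" using E by simp
  show "continuous_map (prod_topology ?T ?T) ?T (\<lambda>(x, y). x + y)"
  proof (rule into)
    fix n
    have "continuous_map (prod_topology ?T ?T) euclidean (\<lambda>z. fst z n + snd z n)"
      by (intro continuous_map_add continuous_map_compose[OF continuous_map_fst coord, unfolded o_def]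
            continuous_map_compose[OF continuous_map_snd coord, unfolded o_def])
    then show "continuous_map (prod_topology ?T ?T) euclidean (\<lambda>z. (case z of (x, y) \<Rightarrow> x + y) n)"
      by (simp add: case_prod_unfold)
  qed (use cseq.subspace_add[OF E] in auto)
  show "continuous_map (prod_topology euclidean ?T) ?T (\<lambda>(c, x). c *\<^sub>c x)"
  proof (rule into)
    fix n
    have 1: "continuous_map (prod_topology euclidean ?T) (euclidean :: complex topology) fst"
      by (rule continuous_map_fst)
    have 2: "continuous_map (prod_topology (euclidean :: complex topology) ?T) euclidean (\<lambda>z. snd z n)"
      by (rule continuous_map_compose[OF continuous_map_snd coord, unfolded o_def])
    have "continuous_map (prod_topology (euclidean :: complex topology) ?T) (prod_topology euclidean euclidean) (\<lambda>z. (fst z, snd z n))"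
      using 1 2 by (rule continuous_map_pairedI)
    moreover have "continuous_map (prod_topology euclidean euclidean) euclidean (\<lambda>p::complex \<times> complex. fst p * snd p)"
      by (simp add: prod_topology_euclidean) (intro continuous_intros)
    ultimately have "continuous_map (prod_topology euclidean ?T) euclidean
        ((\<lambda>p. fst p * snd p) \<circ> (\<lambda>z. (fst z, snd z n)))"
      by (rule continuous_map_compose)
    then show "continuous_map (prod_topology euclidean ?T) euclidean (\<lambda>z. (case z of (c, x) \<Rightarrow> c *\<^sub>c x) n)"
      by (simp add: case_prod_unfold o_def)
  qed (use cseq.subspace_scale[OF E] in auto)
  show "Hausdorff_space ?T"
    by (intro Hausdorff_space_subtopology Hausdorff_space_euclidean)
next
  let ?T = "subtopology (euclidean :: cseq topology) E"
  fix U assume U: "openin ?T U \<and> 0 \<in> U"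
  then obtain O' where O': "open O'" "U = O' \<inter> E"
    by (auto simp: openin_subtopology)
  with U have O0: "openin (product_topology (\<lambda>_. euclidean) UNIV) O'" "0 \<in> O'"
    by (auto simp: euclidean_cseq[symmetric])
  from product_topology_open_contains_basis[OF this]
  obtain X where X: "0 \<in> Pi\<^sub>E UNIV X" "\<And>i. open (X i)" "finite {i. X i \<noteq> UNIV}" "Pi\<^sub>E UNIV X \<subseteq> O'"
    by auto
  have "\<exists>r. 0 < r \<and> ball 0 r \<subseteq> X i" for i
    using X(1,2) open_contains_ball[of "X i"] by (force simp: PiE_def)
  then obtain r where r: "\<And>i. 0 < r i" "\<And>i. ball (0::complex) (r i) \<subseteq> X i" by metis
  define Y where "Y i = (if X i = UNIV then UNIV else ball (0::complex) (r i))" for i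
  have YX: "Pi\<^sub>E UNIV Y \<subseteq> Pi\<^sub>E UNIV X"
    using r by (intro PiE_mono) (auto simp: Y_def)
  have "openin (product_topology (\<lambda>_. euclidean) UNIV) (Pi\<^sub>E UNIV Y)"
  proof (rule product_topology_basis)
    show "finite {i. Y i \<noteq> topspace euclidean}"
      by (rule finite_subset[OF _ X(3)]) (auto simp: Y_def)
  qed (auto simp: Y_def)
  then have "open (Pi\<^sub>E UNIV Y)" by (simp flip: euclidean_cseq)
  then have op: "openin ?T (Pi\<^sub>E UNIV Y \<inter> E)"
    by (auto simp: openin_subtopology)
  have cY: "convex (Y i)" for i by (simp add: Y_def)
  have "convex_cseq (Pi\<^sub>E UNIV Y \<inter> E)"
    unfolding convex_cseq_def
  proof (intro ballI)
    fix x y and t :: real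
    assume xy: "x \<in> Pi\<^sub>E UNIV Y \<inter> E" "y \<in> Pi\<^sub>E UNIV Y \<inter> E" and t: "t \<in> {0..1}"
    have "of_real (1 - t) *\<^sub>c x + of_real t *\<^sub>c y \<in> E"
      using xy by (intro cseq.subspace_add[OF E] cseq.subspace_scale[OF E]) auto
    moreover have "of_real (1 - t) * x i + of_real t * y i \<in> Y i" for i
    proof -
      have "x i \<in> Y i" "y i \<in> Y i" using xy by auto
      then have "(1 - t) *\<^sub>R x i + t *\<^sub>R y i \<in> Y i"
        using t cY by (intro convexD) auto
      then show ?thesis by (simp add: scaleR_conv_of_real)
    qed
    ultimately show "of_real (1 - t) *\<^sub>c x + of_real t *\<^sub>c y \<in> Pi\<^sub>E UNIV Y \<inter> E"
      by auto
  qed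
  moreover have "0 \<in> Pi\<^sub>E UNIV Y \<inter> E"
    using r(1) cseq.subspace_0[OF E] by (auto simp: Y_def)
  ultimately show "\<exists>V. openin ?T V \<and> 0 \<in> V \<and> convex_cseq V \<and> V \<subseteq> U"
    using op subset_trans[OF YX X(4)] O'(2) by (intro exI[of _ "Pi\<^sub>E UNIV Y \<inter> E"] conjI Int_mono) auto
qed

lemma c0_coordinatewise:
  assumes w: "\<And>n. 0 < w n"
  shows "continuous_map (c0_topology w) euclidean (\<lambda>x. x)"
proof -
  interpret Metric_space "c0 w" "\<lambda>x y. c0_norm w (x - y)"
    by (rule Metric_space_c0) (rule w)
  have sub: "cseq_subspace (c0 w)" by (rule c0_subspace) (rule w)
  have "continuous_map mtopology euclidean (\<lambda>x. x n)" for n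
  proof -
    have "\<exists>d>0. \<forall>y. y \<in> c0 w \<and> c0_norm w (x - y) < d \<longrightarrow> dist (x n) (y n) < e"
      if "x \<in> c0 w" "0 < e" for x e
    proof (intro exI[of _ "e * w n"] conjI allI impI)
      show "0 < e * w n" using that w by simp
      fix y assume y: "y \<in> c0 w \<and> c0_norm w (x - y) < e * w n"
      then have "x - y \<in> c0 w"
        using that cseq.subspace_diff[OF sub] by blast
      from c0_norm_upper[OF this, of n] y have "w n * norm (x n - y n) < e * w n" by simp
      then have "norm (x n - y n) < e"
        using w[of n] by (simp add: mult.commute)
      then show "dist (x n) (y n) < e" by (simp add: dist_norm)
    qed
    then have "continuous_map mtopology Met_TC.mtopology (\<lambda>x. x n)"
      unfolding metric_continuous_map[OF Met_TC.Metric_space_axioms] by auto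
    then show ?thesis by (simp add: mtopology_is_euclidean)
  qed
  then show ?thesis
    unfolding c0_topology_def euclidean_cseq continuous_map_componentwise_UNIV by blast
qed

text \<open>
  For \<open>E\<^sub>\<alpha>\<close> the defining description of the inductive limit is therefore not vacuous.
\<close>

lemma is_ind_lim_E_topology:
  assumes s: "mono s" "\<And>k. 1 < s k" and \<alpha>: "\<And>n. 0 < \<alpha> n"
  shows "is_ind_lim (\<lambda>k. c0_topology (E_weight \<alpha> s k)) (E_topology \<alpha> s)"
proof -
  let ?w = "E_weight \<alpha> s"
  let ?S = "\<lambda>k. c0_topology (?w k)"
  define E where "E = (\<Union>k. c0 (?w k))"
  have s0: "0 < s k" for k using s(2)[of k] by linarith
  have w: "0 < ?w k n" for k n using s0[of k] by (simp add: E_weight_def)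
  have mono_w: "?w l n \<le> ?w k n" if "k \<le> l" for k l n
    unfolding E_weight_def using monoD[OF s(1) that] s0[of k] \<alpha>[of n] by (intro powr_mono2') auto
  have mono_c0: "c0 (?w k) \<subseteq> c0 (?w l)" if "k \<le> l" for k l
    using w mono_w[OF that] by (intro c0_antimono)
  have sub: "cseq_subspace (c0 (?w k))" for k
    by (rule c0_subspace) (rule w)
  have top: "topspace (?S k) = c0 (?w k)" for k
    by (rule topspace_c0_topology) (rule w)
  have E: "cseq_subspace E"
    unfolding cseq.subspace_def
  proof (intro conjI ballI allI)
    show "0 \<in> E" unfolding E_def using cseq.subspace_0[OF sub] by blast
  next
    fix x y assume "x \<in> E" "y \<in> E"
    then obtain k l where "x \<in> c0 (?w k)" "y \<in> c0 (?w l)" unfolding E_def by blast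
    then have "x \<in> c0 (?w (max k l))" "y \<in> c0 (?w (max k l))"
      using mono_c0[of k "max k l"] mono_c0[of l "max k l"] by auto
    then show "x + y \<in> E" unfolding E_def using cseq.subspace_add[OF sub] by blast
  next
    fix c :: complex and x assume "x \<in> E"
    then show "c *\<^sub>c x \<in> E" unfolding E_def using cseq.subspace_scale[OF sub] by blast
  qed
  have "lcHs_on_steps ?S (subtopology euclidean E)"
    unfolding lcHs_on_steps_def
  proof (intro conjI allI)
    show "topspace (subtopology euclidean E) = (\<Union>k. topspace (?S k))"
      by (simp add: top E_def)
    show "lcHs (subtopology euclidean E)" by (rule lcHs_coordinatewise[OF E])
    show "continuous_map (?S k) (subtopology euclidean E) (\<lambda>x. x)" for k
      using c0_coordinatewise[of "?w k"] w by (auto simp: continuous_map_in_subtopology top E_def)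
  qed
  from is_ind_lim_ind_lim[OF this] show ?thesis unfolding E_topology_def .
qed


section \<open>Continuous linear operators\<close>

definition linear_on :: "cseq set \<Rightarrow> (cseq \<Rightarrow> cseq) \<Rightarrow> bool"
  where "linear_on X f \<longleftrightarrow>
    (\<forall>x\<in>X. \<forall>y\<in>X. f (x + y) = f x + f y) \<and> (\<forall>c. \<forall>x\<in>X. f (c *\<^sub>c x) = c *\<^sub>c f x)"

text \<open>
  Operators on the space are represented by functions that are \<open>undefined\<close> off the space,
  so that they are determined by their values on it.
\<close>

definition cl_ops :: "cseq topology \<Rightarrow> (cseq \<Rightarrow> cseq) set"
  where "cl_ops T =
    {f \<in> topspace T \<rightarrow>\<^sub>E topspace T. linear_on (topspace T) f \<and> continuous_map T T f}"

definition bounded_in :: "cseq topology \<Rightarrow> cseq set \<Rightarrow> bool"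
  where "bounded_in T B \<longleftrightarrow> B \<subseteq> topspace T \<and>
    (\<forall>U. openin T U \<and> 0 \<in> U \<longrightarrow>
      (\<exists>r>0. \<forall>t::real. t > r \<longrightarrow> B \<subseteq> (\<lambda>x. of_real t *\<^sub>c x) ` U))"

text \<open>
  The sets \<open>{g. \<forall>x\<in>B. g x - f x \<in> U}\<close> form a base of neighbourhoods of \<open>f\<close>; they need not
  themselves be open.
\<close>

definition Lb_open :: "cseq topology \<Rightarrow> (cseq \<Rightarrow> cseq) set \<Rightarrow> bool"
  where "Lb_open T W \<longleftrightarrow> W \<subseteq> cl_ops T \<and>
    (\<forall>f\<in>W. \<exists>B U. bounded_in T B \<and> openin T U \<and> 0 \<in> U \<and>
      {g \<in> cl_ops T. \<forall>x\<in>B. g x - f x \<in> U} \<subseteq> W)"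

definition Lb_topology :: "cseq topology \<Rightarrow> (cseq \<Rightarrow> cseq) topology"
  where "Lb_topology T = topology (Lb_open T)"

lemma bounded_in_Un:
  assumes "bounded_in T A" "bounded_in T B"
  shows "bounded_in T (A \<union> B)"
  unfolding bounded_in_def
proof (intro conjI allI impI)
  show "A \<union> B \<subseteq> topspace T" using assms by (simp add: bounded_in_def)
  fix U assume "openin T U \<and> 0 \<in> U"
  then obtain r1 r2 where r: "0 < r1" "0 < r2"
      "\<And>t::real. t > r1 \<Longrightarrow> A \<subseteq> (\<lambda>x. of_real t *\<^sub>c x) ` U"
      "\<And>t::real. t > r2 \<Longrightarrow> B \<subseteq> (\<lambda>x. of_real t *\<^sub>c x) ` U"
    using assms unfolding bounded_in_def by meson
  then show "\<exists>r>0. \<forall>t::real. t > r \<longrightarrow> A \<union> B \<subseteq> (\<lambda>x. of_real t *\<^sub>c x) ` U"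
    by (intro exI[of _ "max r1 r2"]) (simp add: less_max_iff_disj)
qed

lemma istopology_Lb_open: "istopology (Lb_open T)"
  unfolding istopology_def
proof (intro conjI allI impI)
  fix V W assume V: "Lb_open T V" and W: "Lb_open T W"
  show "Lb_open T (V \<inter> W)"
    unfolding Lb_open_def
  proof (intro conjI ballI)
    show "V \<inter> W \<subseteq> cl_ops T" using V by (auto simp: Lb_open_def)
    fix f assume f: "f \<in> V \<inter> W"
    obtain A U where 1: "bounded_in T A" "openin T U" "0 \<in> U"
        "{g \<in> cl_ops T. \<forall>x\<in>A. g x - f x \<in> U} \<subseteq> V"
      using V f unfolding Lb_open_def by blast
    obtain B U' where 2: "bounded_in T B" "openin T U'" "0 \<in> U'"
        "{g \<in> cl_ops T. \<forall>x\<in>B. g x - f x \<in> U'} \<subseteq> W"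
      using W f unfolding Lb_open_def by blast
    show "\<exists>B U. bounded_in T B \<and> openin T U \<and> 0 \<in> U \<and>
        {g \<in> cl_ops T. \<forall>x\<in>B. g x - f x \<in> U} \<subseteq> V \<inter> W"
      using 1 2 bounded_in_Un[OF 1(1) 2(1)]
      by (intro exI[of _ "A \<union> B"] exI[of _ "U \<inter> U'"]) auto
  qed
next
  fix K assume K: "\<forall>W\<in>K. Lb_open T W"
  show "Lb_open T (\<Union>K)"
    unfolding Lb_open_def
  proof (intro conjI ballI)
    show "\<Union>K \<subseteq> cl_ops T" using K by (auto simp: Lb_open_def)
    fix f assume "f \<in> \<Union>K"
    then obtain W where "W \<in> K" "f \<in> W" by blast
    then show "\<exists>B U. bounded_in T B \<and> openin T U \<and> 0 \<in> U \<and>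
        {g \<in> cl_ops T. \<forall>x\<in>B. g x - f x \<in> U} \<subseteq> \<Union>K"
      using K unfolding Lb_open_def by (meson Union_upper order_trans)
  qed
qed

lemma openin_Lb_topology: "openin (Lb_topology T) = Lb_open T"
  unfolding Lb_topology_def by (rule topology_inverse') (rule istopology_Lb_open)

lemma topspace_Lb_topology:
  assumes "0 \<in> topspace T"
  shows "topspace (Lb_topology T) = cl_ops T"
proof
  show "topspace (Lb_topology T) \<subseteq> cl_ops T"
    using openin_topspace[of "Lb_topology T"] unfolding openin_Lb_topology Lb_open_def by blast
  have "bounded_in T {}" by (auto simp: bounded_in_def intro: exI[of _ 1])
  then have "Lb_open T (cl_ops T)"
    using assms unfolding Lb_open_def by blast
  then show "cl_ops T \<subseteq> topspace (Lb_topology T)"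
    by (metis openin_Lb_topology openin_subset)
qed

definition is_projection_along :: "cseq set \<Rightarrow> (cseq \<Rightarrow> cseq) \<Rightarrow> cseq set \<Rightarrow> cseq set \<Rightarrow> bool"
  where "is_projection_along X P M N \<longleftrightarrow>
    P \<in> X \<rightarrow>\<^sub>E X \<and> linear_on X P \<and> (\<forall>x\<in>X. P (P x) = P x) \<and>
    P ` X = M \<and> {x \<in> X. P x = 0} = N"

definition cesaro :: "cseq \<Rightarrow> cseq"
  where "cesaro x = (\<lambda>n. (\<Sum>i\<le>n. x i) / of_nat (Suc n))"

end

theory Submission
  imports Defs
begin

text \<open>
  Write \<open>v\<^sub>k\<close> for the \<open>k\<close>-th weight, \<open>C\<close> for the Cesaro operator and \<open>P x\<close> for the constant
  sequence with value \<open>x\<^sub>0\<close>, the first entry of \<open>x\<close> (\<open>const_first\<close>). That \<open>C\<^sup>m\<close> converges to \<open>P\<close> rests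
  on three facts.

  Each \<open>v\<^sub>k\<close> is decreasing in \<open>n\<close>, so \<open>C\<close> and \<open>P\<close> map every ball
  \<open>{x. \<forall>n. v\<^sub>k(n) |x\<^sub>n| \<le> M}\<close> into itself (\<open>cesaro_weighted_ball\<close>,
  \<open>const_first_weighted_ball\<close>). Since
  \<open>C\<close> fixes constants, \<open>C\<^sup>m x - P x = C\<^sup>m (x - P x)\<close>, and \<open>x - P x\<close> vanishes at \<open>0\<close>. On sequences
  vanishing at \<open>0\<close>, averaging shrinks the maximum over the indices \<open>0, \<dots>, N\<close> by the factor
  \<open>N / (N + 1)\<close>, because the zero entry takes part in each mean (\<open>cesaro_power_decay\<close>).

  The quotient \<open>v\<^sub>k\<^sub>+\<^sub>1 / v\<^sub>k\<close> tends to \<open>0\<close> as \<open>\<alpha>\<^sub>n \<rightarrow> \<infinity>\<close>. On a \<open>v\<^sub>k\<close>-ball the tails of \<open>C\<^sup>m x - P x\<close> are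
  therefore uniformly small for the weight \<open>v\<^sub>k\<^sub>+\<^sub>1\<close>, and the finitely many remaining entries are
  handled by the previous paragraph. Hence \<open>C\<^sup>m \<rightarrow> P\<close> uniformly on \<open>v\<^sub>k\<close>-balls with respect to the norm
  of the next step (\<open>cesaro_powers_uniform\<close>).

  The inductive limit is regular: each bounded set lies in a ball of some step
  (\<open>bounded_in_step\<close>). So uniform convergence on step balls is convergence in the
  topology of bounded convergence. Regularity is shown by a diagonal argument: if \<open>B\<close> is unbounded
  for every \<open>v\<^sub>k\<close>, a weight \<open>w(n) = v\<^bsub>K(n)\<^esub>(n)\<close> with \<open>K(n) \<rightarrow> \<infinity>\<close> can be chosen for which \<open>B\<close> is still
  unbounded, whereas the inclusion of \<open>E\<^sub>\<alpha>\<close> into \<open>c\<^sub>0(w)\<close> is continuous. That continuity, and the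
  continuity of \<open>C\<^sup>m\<close> and \<open>P\<close>, come from the universal property of the inductive limit
  (\<open>continuous_map_from_ind_lim\<close>).

  Finally, the kernel of \<open>P\<close> is closed and contains the range of \<open>I - C\<close>. Conversely, if
  \<open>P x = 0\<close> then \<open>C\<^sup>m x \<rightarrow> 0\<close>, so \<open>x\<close> is the limit of \<open>x - C\<^sup>m x = (I - C)(x + C x + \<dots> + C\<^sup>m\<^sup>-\<^sup>1 x)\<close>.
\<close>

section \<open>The universal property of the inductive limit\<close>

text \<open>
  The topology pulled back along the graph \<open>x \<mapsto> (x, f x)\<close> is the coarsest refinement of \<open>T\<close> making
  \<open>f\<close> continuous. It inherits all axioms from the product because the graph map is linear, and the
  Hausdorff property because it is finer than \<open>T\<close>.
\<close>

lemma lcHs_graph_pullback: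
  assumes T: "lcHs T" and T2: "lcHs T2" and lin: "linear_on (topspace T) f"
    and maps: "f ` topspace T \<subseteq> topspace T2"
  shows "lcHs (pullback_topology (topspace T) (\<lambda>x. (x, f x)) (prod_topology T T2))"
proof -
  let ?h = "\<lambda>x. (x, f x)"
  let ?Q = "prod_topology T T2"
  let ?G = "pullback_topology (topspace T) ?h ?Q"
  have sub: "cseq_subspace (topspace T)"
    and addT: "continuous_map (prod_topology T T) T (\<lambda>(x, y). x + y)"
    and scT: "continuous_map (prod_topology euclidean T) T (\<lambda>(c, x). c *\<^sub>c x)"
    and cT: "\<And>U. openin T U \<Longrightarrow> 0 \<in> U \<Longrightarrow> \<exists>V. openin T V \<and> 0 \<in> V \<and> convex_cseq V \<and> V \<subseteq> U"
    and hT: "Hausdorff_space T"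
    using T by (auto simp: lcHs_def)
  have addT2: "continuous_map (prod_topology T2 T2) T2 (\<lambda>(x, y). x + y)"
    and scT2: "continuous_map (prod_topology euclidean T2) T2 (\<lambda>(c, x). c *\<^sub>c x)"
    and cT2: "\<And>U. openin T2 U \<Longrightarrow> 0 \<in> U \<Longrightarrow> \<exists>V. openin T2 V \<and> 0 \<in> V \<and> convex_cseq V \<and> V \<subseteq> U"
    using T2 by (auto simp: lcHs_def)
  have f_add: "f (x + y) = f x + f y" if "x \<in> topspace T" "y \<in> topspace T" for x y
    using lin that by (simp add: linear_on_def)
  have f_sc: "f (c *\<^sub>c x) = c *\<^sub>c f x" if "x \<in> topspace T" for c x
    using lin that by (simp add: linear_on_def)
  have topG: "topspace ?G = topspace T"
    using maps by (auto simp: topspace_pullback_topology)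
  have h: "continuous_map ?G ?Q ?h"
    using continuous_map_pullback[of ?Q ?Q id "topspace T" ?h] by (simp add: o_def)
  have idG: "continuous_map ?G T (\<lambda>x. x)"
    using continuous_map_compose[OF h continuous_map_fst] by (simp add: o_def)
  have fG: "continuous_map ?G T2 f"
    using continuous_map_compose[OF h continuous_map_snd] by (simp add: o_def)
  have into: "continuous_map X ?G g" if "continuous_map X T g" "continuous_map X T2 (\<lambda>z. f (g z))"
    for X :: "'z topology" and g
  proof (rule continuous_map_pullback')
    show "continuous_map X ?Q (?h \<circ> g)"
      unfolding o_def using that by (rule continuous_map_pairedI)
    show "topspace X \<subseteq> g -` topspace T"
      using that(1) by (auto simp: continuous_map_def)
  qed
  show ?thesis
    unfolding lcHs_def
  proof (intro conjI allI impI)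
    show "cseq_subspace (topspace ?G)" using sub topG by simp
    show "continuous_map (prod_topology ?G ?G) ?G (\<lambda>(x, y). x + y)"
    proof (rule into)
      have "continuous_map (prod_topology ?G ?G) (prod_topology T T) (\<lambda>z. (fst z, snd z))"
        by (intro continuous_map_pairedI continuous_map_compose[OF continuous_map_fst idG, unfolded o_def]
             continuous_map_compose[OF continuous_map_snd idG, unfolded o_def])
      from continuous_map_compose[OF this addT]
      show "continuous_map (prod_topology ?G ?G) T (\<lambda>(x, y). x + y)"
        by (simp add: o_def case_prod_unfold)
      have "continuous_map (prod_topology ?G ?G) (prod_topology T2 T2) (\<lambda>z. (f (fst z), f (snd z)))"
        by (intro continuous_map_pairedI continuous_map_compose[OF continuous_map_fst fG, unfolded o_def]
             continuous_map_compose[OF continuous_map_snd fG, unfolded o_def])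
      from continuous_map_compose[OF this addT2]
      have "continuous_map (prod_topology ?G ?G) T2 (\<lambda>z. f (fst z) + f (snd z))"
        by (simp add: o_def)
      then show "continuous_map (prod_topology ?G ?G) T2 (\<lambda>z. f (case z of (x, y) \<Rightarrow> x + y))"
        by (rule continuous_map_eq) (auto simp: topG f_add)
    qed
    show "continuous_map (prod_topology euclidean ?G) ?G (\<lambda>(c, x). c *\<^sub>c x)"
    proof (rule into)
      have "continuous_map (prod_topology euclidean ?G) (prod_topology euclidean T) (\<lambda>z. (fst z, snd z))"
        by (intro continuous_map_pairedI continuous_map_fst
             continuous_map_compose[OF continuous_map_snd idG, unfolded o_def])
      from continuous_map_compose[OF this scT]
      show "continuous_map (prod_topology euclidean ?G) T (\<lambda>(c, x). c *\<^sub>c x)"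
        by (simp add: o_def case_prod_unfold)
      have "continuous_map (prod_topology euclidean ?G) (prod_topology euclidean T2)
          (\<lambda>z. (fst z, f (snd z)))"
        by (intro continuous_map_pairedI continuous_map_fst
             continuous_map_compose[OF continuous_map_snd fG, unfolded o_def])
      from continuous_map_compose[OF this scT2]
      have "continuous_map (prod_topology euclidean ?G) T2 (\<lambda>z. fst z *\<^sub>c f (snd z))"
        by (simp add: o_def)
      then show "continuous_map (prod_topology euclidean ?G) T2 (\<lambda>z. f (case z of (c, x) \<Rightarrow> c *\<^sub>c x))"
        by (rule continuous_map_eq) (auto simp: topG f_sc)
    qed
    show "Hausdorff_space ?G"
      by (rule Hausdorff_space_injective_preimage[OF hT idG]) simp
  next
    fix U assume U: "openin ?G U \<and> 0 \<in> U"
    then obtain Q where Q: "openin ?Q Q" "U = ?h -` Q \<inter> topspace T"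
      by (auto simp: openin_pullback_topology)
    have "f 0 = 0"
      using f_sc[OF cseq.subspace_0[OF sub], of 0] by (simp add: fun_eq_iff)
    with Q U have "(0, 0) \<in> Q" by simp
    with Q(1) obtain A B where AB: "openin T A" "openin T2 B" "0 \<in> A" "0 \<in> B" "A \<times> B \<subseteq> Q"
      unfolding openin_prod_topology_alt by meson
    obtain V W where V: "openin T V" "0 \<in> V" "convex_cseq V" "V \<subseteq> A"
      and W: "openin T2 W" "0 \<in> W" "convex_cseq W" "W \<subseteq> B"
      using cT[OF AB(1,3)] cT2[OF AB(2,4)] by blast
    let ?N = "?h -` (V \<times> W) \<inter> topspace T"
    have "openin ?Q (V \<times> W)" using V(1) W(1) by (simp add: openin_prod_Times_iff)
    then have "openin ?G ?N" unfolding openin_pullback_topology by blast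
    moreover have "0 \<in> ?N"
      using V(2) W(2) \<open>f 0 = 0\<close> cseq.subspace_0[OF sub] by simp
    moreover have "convex_cseq ?N"
      unfolding convex_cseq_def
    proof (intro ballI)
      fix x y and t :: real
      assume xy: "x \<in> ?N" "y \<in> ?N" and t: "t \<in> {0..1}"
      let ?z = "of_real (1 - t) *\<^sub>c x + of_real t *\<^sub>c y"
      have x': "x \<in> topspace T" "y \<in> topspace T" using xy by auto
      have sc: "c *\<^sub>c x \<in> topspace T" "c *\<^sub>c y \<in> topspace T" for c
        using x' cseq.subspace_scale[OF sub] by blast+
      have "f ?z = of_real (1 - t) *\<^sub>c f x + of_real t *\<^sub>c f y"
        by (simp only: f_add[OF sc] f_sc[OF x'(1)] f_sc[OF x'(2)])
      also have "\<dots> \<in> W" using W(3) xy t unfolding convex_cseq_def by blast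
      finally have "f ?z \<in> W" .
      moreover have "?z \<in> V" using V(3) xy t unfolding convex_cseq_def by blast
      moreover have "?z \<in> topspace T" using sc cseq.subspace_add[OF sub] by blast
      ultimately show "?z \<in> ?N" by simp
    qed
    moreover have "V \<times> W \<subseteq> Q" using AB(5) V(4) W(4) by blast
    then have "?N \<subseteq> U" unfolding Q(2) by blast
    ultimately show "\<exists>V. openin ?G V \<and> 0 \<in> V \<and> convex_cseq V \<and> V \<subseteq> U" by blast
  qed
qed

text \<open>
  Refining the inductive limit topology by the graph of \<open>f\<close> gives another admissible topology on the
  steps; as the inductive limit is already the finest one, the refinement changes nothing.
\<close>

lemma continuous_map_from_ind_lim:
  assumes T: "is_ind_lim S T" and T2: "lcHs T2" and lin: "linear_on (topspace T) f"
    and steps: "\<And>k. continuous_map (S k) T2 f"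
  shows "continuous_map T T2 f"
proof -
  let ?h = "\<lambda>x. (x, f x)"
  let ?Q = "prod_topology T T2"
  let ?G = "pullback_topology (topspace T) ?h ?Q"
  have lcT: "lcHs T" and topT: "topspace T = (\<Union>k. topspace (S k))"
    and incl: "\<And>k. continuous_map (S k) T (\<lambda>x. x)"
    using T by (auto simp: is_ind_lim_def lcHs_on_steps_def)
  have maps: "f ` topspace T \<subseteq> topspace T2"
    using steps topT by (auto simp: continuous_map_def)
  have "lcHs_on_steps S ?G"
    unfolding lcHs_on_steps_def
  proof (intro conjI allI)
    show "topspace ?G = (\<Union>k. topspace (S k))"
      using maps topT by (auto simp: topspace_pullback_topology)
    show "lcHs ?G" by (rule lcHs_graph_pullback[OF lcT T2 lin maps])
    show "continuous_map (S k) ?G (\<lambda>x. x)" for k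
    proof (rule continuous_map_pullback')
      show "continuous_map (S k) ?Q (?h \<circ> (\<lambda>x. x))"
        unfolding o_def using incl steps by (rule continuous_map_pairedI)
    qed (use topT in auto)
  qed
  then have finer: "openin ?G U \<Longrightarrow> openin T U" for U
    using T unfolding is_ind_lim_def by blast
  have "continuous_map ?G ?Q ?h"
    using continuous_map_pullback[of ?Q ?Q id "topspace T" ?h] by (simp add: o_def)
  from continuous_map_compose[OF this continuous_map_snd]
  have "continuous_map ?G T2 f" by (simp add: o_def)
  moreover have "continuous_map T ?G (\<lambda>x. x)"
    unfolding continuous_map_alt
  proof (intro conjI strip)
    fix U assume "openin ?G U"
    from finer[OF this] show "openin T ((\<lambda>x. x) -` U \<inter> topspace T)" by (simp add: openin_Int)
  qed (use maps in \<open>auto simp: topspace_pullback_topology\<close>)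
  ultimately show ?thesis by (rule continuous_map_finer)
qed

section \<open>Weighted null sequences as normed spaces\<close>

text \<open>
  These are balls of the weighted \<open>\<ell>\<^sub>\<infinity>\<close> space: members need not be null sequences for \<open>w\<close>. Working with
  them replaces norm estimates by entrywise inequalities, and a ball for one step weight lies in the
  next step.
\<close>

definition weighted_ball :: "(nat \<Rightarrow> real) \<Rightarrow> real \<Rightarrow> cseq set"
  where "weighted_ball w M = {x. \<forall>n. w n * norm (x n) \<le> M}"

lemma weighted_ballI: "(\<And>n. w n * norm (x n) \<le> M) \<Longrightarrow> x \<in> weighted_ball w M"
  by (simp add: weighted_ball_def)

lemma weighted_ballD: "x \<in> weighted_ball w M \<Longrightarrow> w n * norm (x n) \<le> M"
  by (simp add: weighted_ball_def)

lemma c0_norm_le_iff: "x \<in> c0 w \<Longrightarrow> c0_norm w x \<le> r \<longleftrightarrow> x \<in> weighted_ball w r"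
  by (meson c0_norm_least c0_norm_upper order_trans weighted_ballD weighted_ballI)

lemma c0_norm_triangle:
  assumes w: "\<And>n. 0 < w n" and x: "x \<in> c0 w" "y \<in> c0 w"
  shows "c0_norm w (x + y) \<le> c0_norm w x + c0_norm w y"
proof (rule c0_norm_least)
  show "x + y \<in> c0 w" using x cseq.subspace_add[OF c0_subspace, of w] w by blast
  fix n
  have "w n * norm ((x + y) n) \<le> w n * (norm (x n) + norm (y n))"
    using w[of n] norm_triangle_ineq[of "x n" "y n"] by (intro mult_left_mono) auto
  also have "\<dots> \<le> c0_norm w x + c0_norm w y"
    using c0_norm_upper[OF x(1), of n] c0_norm_upper[OF x(2), of n] by (simp add: distrib_left)
  finally show "w n * norm ((x + y) n) \<le> c0_norm w x + c0_norm w y" .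
qed

lemma c0_norm_scale:
  assumes w: "\<And>n. 0 < w n" and x: "x \<in> c0 w"
  shows "c0_norm w (c *\<^sub>c x) \<le> norm c * c0_norm w x"
proof (rule c0_norm_least)
  show "c *\<^sub>c x \<in> c0 w" using x cseq.subspace_scale[OF c0_subspace, of w] w by blast
  fix n
  have "w n * norm ((c *\<^sub>c x) n) = norm c * (w n * norm (x n))" by (simp add: norm_mult)
  also have "\<dots> \<le> norm c * c0_norm w x"
    using c0_norm_upper[OF x, of n] by (intro mult_left_mono) auto
  finally show "w n * norm ((c *\<^sub>c x) n) \<le> norm c * c0_norm w x" .
qed

lemma lcHs_c0_topology:
  assumes w: "\<And>n. 0 < w n"
  shows "lcHs (c0_topology w)"
proof -
  interpret Metric_space "c0 w" "\<lambda>x y. c0_norm w (x - y)"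
    by (rule Metric_space_c0) (rule w)
  have T: "c0_topology w = mtopology" by (simp add: c0_topology_def)
  have sub: "cseq_subspace (c0 w)" by (rule c0_subspace) (rule w)
  note add = cseq.subspace_add[OF sub] and scale = cseq.subspace_scale[OF sub]
    and diff = cseq.subspace_diff[OF sub] and zero = cseq.subspace_0[OF sub]
  have nn: "0 \<le> c0_norm w x" if "x \<in> c0 w" for x
    using nonneg[of x 0] by simp
  have norm_0: "c0_norm w 0 = 0"
    using mdist_zero[OF zero] by simp
  show ?thesis
    unfolding lcHs_def T
  proof (intro conjI allI impI)
    show "cseq_subspace (topspace mtopology)" using sub by simp
    show "Hausdorff_space mtopology" by (rule Hausdorff_space_mtopology)
    show "continuous_map (prod_topology mtopology mtopology) mtopology (\<lambda>(x, y). x + y)"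
      unfolding continuous_map_to_metric
    proof (intro ballI allI impI)
      fix p and \<epsilon> :: real assume p: "p \<in> topspace (prod_topology mtopology mtopology)" and e: "0 < \<epsilon>"
      obtain a b where ab: "p = (a, b)" "a \<in> c0 w" "b \<in> c0 w" using p by auto
      let ?U = "mball a (\<epsilon>/2) \<times> mball b (\<epsilon>/2)"
      have "(\<lambda>(x, y). x + y) q \<in> mball ((\<lambda>(x, y). x + y) p) \<epsilon>" if qU: "q \<in> ?U" for q
      proof -
        obtain x y where q: "q = (x, y)" "x \<in> c0 w" "y \<in> c0 w"
          "c0_norm w (a - x) < \<epsilon>/2" "c0_norm w (b - y) < \<epsilon>/2"
          using qU by auto
        have "c0_norm w ((a - x) + (b - y)) \<le> c0_norm w (a - x) + c0_norm w (b - y)"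
          using ab q w by (intro c0_norm_triangle diff)
        moreover have "(a - x) + (b - y) = (a + b) - (x + y)" by simp
        ultimately have "c0_norm w ((a + b) - (x + y)) < \<epsilon>" using q by simp
        then show ?thesis using ab q add by (simp add: in_mball)
      qed
      moreover have "openin (prod_topology mtopology mtopology) ?U" "p \<in> ?U"
        using ab e norm_0 by (auto simp: openin_prod_Times_iff)
      ultimately show "\<exists>U. openin (prod_topology mtopology mtopology) U \<and> p \<in> U \<and>
          (\<forall>q\<in>U. (\<lambda>(x, y). x + y) q \<in> mball ((\<lambda>(x, y). x + y) p) \<epsilon>)" by blast
    qed
    show "continuous_map (prod_topology euclidean mtopology) mtopology (\<lambda>(c, x). c *\<^sub>c x)"
      unfolding continuous_map_to_metric
    proof (intro ballI allI impI)
      fix p :: "complex \<times> cseq" and \<epsilon> :: real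
      assume p: "p \<in> topspace (prod_topology euclidean mtopology)" and e: "0 < \<epsilon>"
      obtain c a where ca: "p = (c, a)" "a \<in> c0 w" using p by auto
      define D where "D = norm c + c0_norm w a + 2"
      define \<delta> where "\<delta> = min 1 (\<epsilon> / D)"
      have D: "0 < D" using nn[OF ca(2)] norm_ge_zero[of c] unfolding D_def by linarith
      have d: "0 < \<delta>" "\<delta> \<le> 1" using D e by (auto simp: \<delta>_def)
      have dD: "\<delta> * D \<le> \<epsilon>" using D by (simp add: \<delta>_def min_def field_simps)
      let ?U = "ball c \<delta> \<times> mball a \<delta>"
      have "(\<lambda>(c, x). c *\<^sub>c x) q \<in> mball ((\<lambda>(c, x). c *\<^sub>c x) p) \<epsilon>" if qU: "q \<in> ?U" for q
      proof -
        obtain c' x where q: "q = (c', x)" "x \<in> c0 w" "norm (c - c') < \<delta>" "c0_norm w (a - x) < \<delta>"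
          using qU by (auto simp: dist_norm)
        have "c0_norm w (a - x) = c0_norm w (x - a)" by (rule commute)
        with c0_norm_triangle[OF w diff[OF q(2) ca(2)] ca(2)] q(4) d
        have x: "c0_norm w x \<le> c0_norm w a + 1" by simp
        have "c *\<^sub>c a - c' *\<^sub>c x = c *\<^sub>c (a - x) + (c - c') *\<^sub>c x"
          by (simp add: fun_eq_iff algebra_simps)
        then have "c0_norm w (c *\<^sub>c a - c' *\<^sub>c x) \<le> c0_norm w (c *\<^sub>c (a - x)) + c0_norm w ((c - c') *\<^sub>c x)"
          using ca q w by (simp add: c0_norm_triangle diff scale)
        also have "\<dots> \<le> norm c * c0_norm w (a - x) + norm (c - c') * c0_norm w x"
          using ca q w by (intro add_mono c0_norm_scale diff)
        also have "\<dots> \<le> norm c * \<delta> + \<delta> * (c0_norm w a + 1)"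
          using q x nn d by (intro add_mono mult_left_mono mult_mono) auto
        also have "\<dots> < \<delta> * D" using d by (simp add: D_def algebra_simps)
        also note dD
        finally show ?thesis using ca q scale by (simp add: in_mball)
      qed
      moreover have "openin (prod_topology euclidean mtopology) ?U" "p \<in> ?U"
        using ca d norm_0 by (auto simp: openin_prod_Times_iff)
      ultimately show "\<exists>U. openin (prod_topology euclidean mtopology) U \<and> p \<in> U \<and>
          (\<forall>q\<in>U. (\<lambda>(c, x). c *\<^sub>c x) q \<in> mball ((\<lambda>(c, x). c *\<^sub>c x) p) \<epsilon>)" by blast
    qed
  next
    fix U assume U: "openin mtopology U \<and> 0 \<in> U"
    then obtain r where r: "0 < r" "mball 0 r \<subseteq> U" unfolding openin_mtopology by blast
    have ball: "x \<in> mball 0 r \<longleftrightarrow> x \<in> c0 w \<and> c0_norm w x < r" for x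
      using zero commute[of 0 x] by (auto simp: in_mball)
    have "convex_cseq (mball 0 r)"
      unfolding convex_cseq_def
    proof (intro ballI)
      fix x y and t :: real
      assume xy: "x \<in> mball 0 r" "y \<in> mball 0 r" and t: "t \<in> {0..1}"
      have x: "x \<in> c0 w" "c0_norm w x < r" and y: "y \<in> c0 w" "c0_norm w y < r"
        using xy ball by auto
      let ?c = "complex_of_real (1 - t)" and ?d = "complex_of_real t"
      have "c0_norm w (?c *\<^sub>c x + ?d *\<^sub>c y) \<le> c0_norm w (?c *\<^sub>c x) + c0_norm w (?d *\<^sub>c y)"
        using x y w by (intro c0_norm_triangle scale)
      also have "\<dots> \<le> norm ?c * c0_norm w x + norm ?d * c0_norm w y"
        using x y w by (intro add_mono c0_norm_scale)
      also have "\<dots> = (1 - t) * c0_norm w x + t * c0_norm w y"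
        using t unfolding norm_of_real by simp
      also have "\<dots> < r" using x y t by (intro convex_bound_lt) auto
      finally show "?c *\<^sub>c x + ?d *\<^sub>c y \<in> mball 0 r"
        using x y by (simp only: ball) (simp add: add scale)
    qed
    then show "\<exists>V. openin mtopology V \<and> 0 \<in> V \<and> convex_cseq V \<and> V \<subseteq> U"
      using r zero norm_0 by (intro exI[of _ "mball 0 r"]) auto
  qed
qed

lemma linear_on_diff: "linear_on UNIV f \<Longrightarrow> f (x - y) = f x - f y"
  unfolding linear_on_def by (metis UNIV_I add_diff_cancel diff_add_cancel)

lemma continuous_map_c0:
  assumes w: "\<And>n. 0 < w n" and w': "\<And>n. 0 < w' n" and lin: "linear_on UNIV f"
    and maps: "f ` c0 w \<subseteq> c0 w'" and c: "0 < c"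
    and bound: "\<And>r. f ` weighted_ball w r \<subseteq> weighted_ball w' (c * r)"
  shows "continuous_map (c0_topology w) (c0_topology w') f"
proof -
  interpret W: Metric_space "c0 w" "\<lambda>x y. c0_norm w (x - y)"
    by (rule Metric_space_c0) (rule w)
  have W': "Metric_space (c0 w') (\<lambda>x y. c0_norm w' (x - y))"
    by (rule Metric_space_c0) (rule w')
  note diff = cseq.subspace_diff[OF c0_subspace]
  have f_diff: "f x - f y = f (x - y)" for x y
    by (simp only: linear_on_diff[OF lin])
  have "\<exists>\<delta>>0. \<forall>x. x \<in> c0 w \<and> c0_norm w (a - x) < \<delta> \<longrightarrow> c0_norm w' (f a - f x) < \<epsilon>"
    if a: "a \<in> c0 w" and e: "0 < \<epsilon>" for a \<epsilon>
  proof (intro exI[of _ "\<epsilon> / (2 * c)"] conjI allI impI)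
    show "0 < \<epsilon> / (2 * c)" using e c by simp
    fix x assume x: "x \<in> c0 w \<and> c0_norm w (a - x) < \<epsilon> / (2 * c)"
    have "a - x \<in> c0 w" using a x w diff by blast
    with x have "a - x \<in> weighted_ball w (\<epsilon> / (2 * c))"
      by (simp flip: c0_norm_le_iff)
    then have "f (a - x) \<in> weighted_ball w' (c * (\<epsilon> / (2 * c)))" using bound by blast
    moreover have "f (a - x) \<in> c0 w'" using maps \<open>a - x \<in> c0 w\<close> by blast
    ultimately have "c0_norm w' (f a - f x) \<le> c * (\<epsilon> / (2 * c))"
      by (simp only: f_diff c0_norm_le_iff)
    also have "\<dots> < \<epsilon>" using c e by simp
    finally show "c0_norm w' (f a - f x) < \<epsilon>" .
  qed
  then show ?thesis
    unfolding c0_topology_def W.metric_continuous_map[OF W'] using maps by blast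
qed

section \<open>The Cesaro operator on weighted balls\<close>

definition const_first :: "cseq \<Rightarrow> cseq"
  where "const_first x = (\<lambda>_. x 0)"

lemma linear_const_first: "linear_on UNIV const_first"
  by (simp add: linear_on_def const_first_def fun_eq_iff)

lemma linear_cesaro: "linear_on UNIV cesaro"
  by (simp add: linear_on_def cesaro_def fun_eq_iff sum.distrib add_divide_distrib sum_distrib_left)

lemma linear_cesaro_power: "linear_on UNIV (cesaro ^^ m)"
  using linear_cesaro by (induction m) (auto simp: linear_on_def)

lemma cesaro_const_first: "cesaro (const_first x) = const_first x"
  by (simp add: cesaro_def const_first_def fun_eq_iff del: of_nat_Suc)

lemma cesaro_power_const_first: "(cesaro ^^ m) (const_first x) = const_first x"
  by (induction m) (auto simp: cesaro_const_first)

lemma cesaro_power_at_0: "(cesaro ^^ m) x 0 = x 0"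
  by (induction m) (auto simp: cesaro_def)

lemma cesaro_power_diff:
  "(cesaro ^^ m) x - const_first x = (cesaro ^^ m) (x - const_first x)"
  by (simp add: linear_on_diff[OF linear_cesaro_power] cesaro_power_const_first)

text \<open>
  For a decreasing weight, \<open>w(n)\<close> times the mean of \<open>|x\<^sub>0|, \<dots>, |x\<^sub>n|\<close> is at most the mean of the
  numbers \<open>w(i) |x\<^sub>i|\<close>.
\<close>

lemma cesaro_weighted_ball:
  assumes pos: "\<And>n. 0 < w n" and w: "decseq w" and x: "x \<in> weighted_ball w M"
  shows "cesaro x \<in> weighted_ball w M"
proof (rule weighted_ballI)
  fix n
  have "w n * norm (cesaro x n) = w n * norm (\<Sum>i\<le>n. x i) / real (Suc n)"
    by (simp add: cesaro_def norm_divide del: of_nat_Suc)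
  also have "\<dots> \<le> w n * (\<Sum>i\<le>n. norm (x i)) / real (Suc n)"
    using pos[of n] by (intro divide_right_mono mult_left_mono norm_sum) auto
  also have "\<dots> = (\<Sum>i\<le>n. w n * norm (x i)) / real (Suc n)" by (simp add: sum_distrib_left)
  also have "\<dots> \<le> (\<Sum>i\<le>n. M) / real (Suc n)"
  proof (intro divide_right_mono sum_mono)
    fix i assume "i \<in> {..n}"
    then have "w n * norm (x i) \<le> w i * norm (x i)"
      using w by (intro mult_right_mono) (auto simp: decseq_def)
    also have "\<dots> \<le> M" by (rule weighted_ballD[OF x])
    finally show "w n * norm (x i) \<le> M" .
  qed auto
  also have "\<dots> = M" by (simp del: of_nat_Suc)
  finally show "w n * norm (cesaro x n) \<le> M" .
qed

lemma cesaro_power_weighted_ball: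
  assumes "\<And>n. 0 < w n" "decseq w" "x \<in> weighted_ball w M"
  shows "(cesaro ^^ m) x \<in> weighted_ball w M"
  by (induction m) (use assms in \<open>auto intro: cesaro_weighted_ball\<close>)

lemma const_first_weighted_ball:
  assumes w: "decseq w" and x: "x \<in> weighted_ball w M"
  shows "const_first x \<in> weighted_ball w M"
proof (rule weighted_ballI)
  fix n
  have "w n * norm (x 0) \<le> w 0 * norm (x 0)"
    using w by (intro mult_right_mono) (auto simp: decseq_def)
  also have "\<dots> \<le> M" by (rule weighted_ballD[OF x])
  finally show "w n * norm (const_first x n) \<le> M" by (simp add: const_first_def)
qed

text \<open>
  The mean over \<open>0, \<dots>, i\<close> has at most \<open>i\<close> nonzero terms, so it is bounded by
  \<open>i / (i + 1) \<le> N / (N + 1)\<close> times the maximum; the entry at \<open>0\<close> stays zero, which allows iteration.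
\<close>

lemma cesaro_power_decay:
  assumes z0: "z 0 = 0" and z: "\<And>i. i \<le> N \<Longrightarrow> norm (z i) \<le> D" and i: "i \<le> N"
  shows "norm ((cesaro ^^ m) z i) \<le> (real N / real (Suc N)) ^ m * D"
  using i
proof (induction m arbitrary: i)
  case 0
  then show ?case using z by simp
next
  case (Suc m)
  let ?y = "(cesaro ^^ m) z" and ?B = "(real N / real (Suc N)) ^ m * D"
  have "0 \<le> D" using z[of 0] norm_ge_zero[of "z 0"] by linarith
  then have B: "0 \<le> ?B" by simp
  have y0: "?y 0 = 0" using z0 by (simp add: cesaro_power_at_0)
  have split: "(\<Sum>j\<le>i. ?y j) = (\<Sum>j=1..i. ?y j)"
    using y0 by (simp add: atMost_atLeast0 sum.atLeast_Suc_atMost)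
  have "norm (\<Sum>j=1..i. ?y j) \<le> (\<Sum>j=1..i. ?B)"
    by (rule sum_norm_le) (use Suc in auto)
  then have "norm (\<Sum>j\<le>i. ?y j) \<le> real i * ?B" by (simp add: split)
  then have "norm (\<Sum>j\<le>i. ?y j) / real (Suc i) \<le> real i * ?B / real (Suc i)"
    by (intro divide_right_mono) auto
  also have "\<dots> = real i / real (Suc i) * ?B" by simp
  also have "\<dots> \<le> real N / real (Suc N) * ?B"
    using Suc.prems B by (intro mult_right_mono) (auto simp: field_simps)
  also have "norm (\<Sum>j\<le>i. ?y j) / real (Suc i) = norm (cesaro ?y i)"
    unfolding cesaro_def norm_divide norm_of_nat ..
  finally show ?case by (simp add: mult.assoc)
qed

text \<open>
  This is \<open>x - C\<^sup>m x = (I - C)(x + C x + \<dots> + C\<^sup>m\<^sup>-\<^sup>1 x)\<close>, with one summand added per induction step.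
\<close>

lemma cesaro_power_telescope:
  assumes X: "cseq_subspace X" and inv: "\<And>x. x \<in> X \<Longrightarrow> cesaro x \<in> X" and x: "x \<in> X"
  shows "x - (cesaro ^^ m) x \<in> (\<lambda>x. x - cesaro x) ` X"
proof (induction m)
  case 0
  have "x - (cesaro ^^ 0) x = 0 - cesaro 0" by (simp add: cesaro_def fun_eq_iff)
  then show ?case using cseq.subspace_0[OF X] by (rule image_eqI)
next
  case (Suc m)
  let ?y = "(cesaro ^^ m) x"
  from Suc obtain u where u: "x - ?y = u - cesaro u" "u \<in> X" by (rule imageE)
  have y: "?y \<in> X" by (induction m) (auto simp: x inv)
  have "cesaro (u + ?y) = cesaro u + cesaro ?y"
    using linear_cesaro by (simp add: linear_on_def)
  then have "x - (cesaro ^^ Suc m) x = (u + ?y) - cesaro (u + ?y)"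
    using u(1) by (simp add: algebra_simps)
  moreover have "u + ?y \<in> X" using u(2) y cseq.subspace_add[OF X] by blast
  ultimately show ?case by blast
qed

section \<open>The power weights and the steps\<close>

locale power_weights =
  fixes \<alpha> s :: "nat \<Rightarrow> real"
  assumes alpha_pos: "\<And>n. 0 < \<alpha> n" and alpha_mono: "strict_mono \<alpha>"
    and alpha_lim: "filterlim \<alpha> at_top sequentially"
    and s_gt_1: "\<And>k. 1 < s k" and s_mono: "strict_mono s"
begin

abbreviation "v \<equiv> E_weight \<alpha> s"
abbreviation "T \<equiv> E_topology \<alpha> s"
abbreviation "E \<equiv> topspace T"

lemma s_pos: "0 < s k"
  using s_gt_1[of k] by linarith

lemma weight_pos: "0 < v k n"
  using s_pos[of k] by (simp add: E_weight_def)

lemma weight_le_1: "v k n \<le> 1"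
  using powr_mono[of "- \<alpha> n" 0 "s k"] s_gt_1[of k] alpha_pos[of n] by (simp add: E_weight_def)

lemma weight_step_mono: "k \<le> l \<Longrightarrow> v l n \<le> v k n"
  unfolding E_weight_def using strict_mono_mono[OF s_mono, THEN monoD, of k l] s_pos[of k] alpha_pos[of n]
  by (intro powr_mono2') auto

lemma weight_decseq: "decseq (v k)"
  unfolding E_weight_def decseq_def
  using strict_mono_mono[OF alpha_mono] s_gt_1[of k] by (auto intro!: powr_mono simp: monoD)

lemma weight_ratio_null: "(\<lambda>n. v (Suc k) n / v k n) \<longlonglongrightarrow> 0"
proof -
  let ?a = "s (Suc k) / s k"
  have a: "1 < ?a" using strict_monoD[OF s_mono, of k "Suc k"] s_pos[of k] by simp
  have "filterlim (\<lambda>n. - ln ?a * \<alpha> n) at_bot sequentially"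
    using ln_gt_zero[OF a] alpha_lim by (intro filterlim_tendsto_neg_mult_at_bot[OF tendsto_const]) auto
  from filterlim_compose[OF exp_at_bot this]
  have "(\<lambda>n. exp (- ln ?a * \<alpha> n)) \<longlonglongrightarrow> 0" .
  moreover have "exp (- ln ?a * \<alpha> n) = v (Suc k) n / v k n" for n
  proof -
    have "v (Suc k) n / v k n = ?a powr (- \<alpha> n)"
      using s_pos[of k] s_pos[of "Suc k"] by (simp add: E_weight_def powr_divide)
    also have "\<dots> = exp (- ln ?a * \<alpha> n)"
      using a s_pos[of k] s_pos[of "Suc k"] by (simp add: powr_def mult.commute)
    finally show ?thesis by simp
  qed
  ultimately show ?thesis by simp
qed

lemma ball_subset_next_c0: "weighted_ball (v k) M \<subseteq> c0 (v (Suc k))"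
proof
  fix x assume x: "x \<in> weighted_ball (v k) M"
  have lim: "(\<lambda>n. v (Suc k) n / v k n * M) \<longlonglongrightarrow> 0"
    using tendsto_mult_right_zero[OF weight_ratio_null] tendsto_mult_left_zero[OF weight_ratio_null] by simp
  have le: "v (Suc k) n * norm (x n) \<le> v (Suc k) n / v k n * M" for n
  proof -
    have "v (Suc k) n * norm (x n) = v (Suc k) n / v k n * (v k n * norm (x n))"
      using weight_pos[of k n] by simp
    also have "\<dots> \<le> v (Suc k) n / v k n * M"
      using weight_pos weighted_ballD[OF x] by (intro mult_left_mono) (auto simp: less_imp_le)
    finally show ?thesis .
  qed
  have "(\<lambda>n. v (Suc k) n * norm (x n)) \<longlonglongrightarrow> 0"
    by (rule tendsto_sandwich[OF _ _ tendsto_const lim])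
       (use le weight_pos in \<open>auto simp: less_imp_le\<close>)
  then show "x \<in> c0 (v (Suc k))" by (simp add: c0_def)
qed

lemma step_diff: "x \<in> c0 (v k) \<Longrightarrow> y \<in> c0 (v k) \<Longrightarrow> x - y \<in> c0 (v k)"
  using cseq.subspace_diff[OF c0_subspace, of "v k"] weight_pos by blast

lemma c0_imp_ball: "x \<in> c0 (v k) \<Longrightarrow> x \<in> weighted_ball (v k) (c0_norm (v k) x)"
  by (simp flip: c0_norm_le_iff)

lemma topspace_step: "topspace (c0_topology (v k)) = c0 (v k)"
  using weight_pos by (rule topspace_c0_topology)

lemma ind_lim_T: "is_ind_lim (\<lambda>k. c0_topology (v k)) T"
  using s_mono s_gt_1 alpha_pos by (intro is_ind_lim_E_topology) (auto simp: strict_mono_mono)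

lemma lcHs_T: "lcHs T" and E_eq: "E = (\<Union>k. c0 (v k))"
  and step_inclusion: "continuous_map (c0_topology (v k)) T (\<lambda>x. x)"
  using ind_lim_T by (auto simp: is_ind_lim_def lcHs_on_steps_def topspace_step)

lemma subspace_E: "cseq_subspace E"
  using lcHs_T by (simp add: lcHs_def)

lemma E_iff_ball: "x \<in> E \<longleftrightarrow> (\<exists>k M. x \<in> weighted_ball (v k) M)"
  using c0_imp_ball ball_subset_next_c0 unfolding E_eq by blast

text \<open>
  Convergence in a step implies convergence in the inductive limit, because the inclusion of a step
  is continuous.
\<close>

lemma neighbourhood_contains_ball:
  assumes U: "openin T U" "x \<in> U" and x: "x \<in> c0 (v k)"
  obtains \<epsilon> where "0 < \<epsilon>"
    "\<And>y. y \<in> c0 (v k) \<Longrightarrow> y - x \<in> weighted_ball (v k) \<epsilon> \<Longrightarrow> y \<in> U"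
proof -
  interpret Metric_space "c0 (v k)" "\<lambda>x y. c0_norm (v k) (x - y)"
    by (rule Metric_space_c0) (rule weight_pos)
  have "openin mtopology {y \<in> c0 (v k). y \<in> U}"
    using step_inclusion[of k] U(1) unfolding continuous_map_def topspace_step
    by (simp add: c0_topology_def)
  moreover have "x \<in> {y \<in> c0 (v k). y \<in> U}" using x U(2) by simp
  ultimately have "\<exists>r>0. mball x r \<subseteq> {y \<in> c0 (v k). y \<in> U}"
    by (simp only: openin_mtopology)
  then obtain r where r: "0 < r" "mball x r \<subseteq> U" by auto
  show thesis
  proof (rule that[of "r/2"])
    fix y assume y: "y \<in> c0 (v k)" "y - x \<in> weighted_ball (v k) (r/2)"
    have "y - x \<in> c0 (v k)" using y(1) x step_diff by blast
    with y(2) have "c0_norm (v k) (y - x) \<le> r/2" by (simp only: c0_norm_le_iff)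
    then have "y \<in> mball x r" using x y(1) r(1) commute[of x y] by (simp add: in_mball)
    then show "y \<in> U" using r(2) by blast
  qed (use r in simp)
qed

section \<open>Continuous operators and regularity\<close>

text \<open>
  Such an \<open>f\<close> maps \<open>c\<^sub>0(v\<^sub>k)\<close> continuously into \<open>c\<^sub>0(v\<^sub>k\<^sub>+\<^sub>1)\<close>: passing to the next step spares a proof
  that \<open>f\<close> preserves null sequences.
\<close>

lemma restrict_in_cl_ops:
  assumes lin: "linear_on UNIV f"
    and balls: "\<And>k M. f ` weighted_ball (v k) M \<subseteq> weighted_ball (v k) M"
  shows "restrict f E \<in> cl_ops T"
proof -
  have "continuous_map (c0_topology (v k)) T f" for k
  proof -
    have "continuous_map (c0_topology (v k)) (c0_topology (v (Suc k))) f"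
    proof (rule continuous_map_c0[where c = 1])
      show "f ` c0 (v k) \<subseteq> c0 (v (Suc k))"
        using c0_imp_ball balls ball_subset_next_c0 by blast
      fix r
      show "f ` weighted_ball (v k) r \<subseteq> weighted_ball (v (Suc k)) (1 * r)"
      proof clarify
        fix x assume "x \<in> weighted_ball (v k) r"
        then have fx: "f x \<in> weighted_ball (v k) r" using balls by blast
        show "f x \<in> weighted_ball (v (Suc k)) (1 * r)"
        proof (rule weighted_ballI)
          fix n
          have "v (Suc k) n * norm (f x n) \<le> v k n * norm (f x n)"
            by (intro mult_right_mono weight_step_mono) auto
          with weighted_ballD[OF fx, of n] show "v (Suc k) n * norm (f x n) \<le> 1 * r" by simp
        qed
      qed
    qed (use lin weight_pos in auto)
    from continuous_map_compose[OF this step_inclusion] show ?thesis by (simp add: o_def)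
  qed
  then have cont: "continuous_map T T f"
    using lin by (intro continuous_map_from_ind_lim[OF ind_lim_T lcHs_T]) (auto simp: linear_on_def)
  have "linear_on E (restrict f E)"
    using lin cseq.subspace_add[OF subspace_E] cseq.subspace_scale[OF subspace_E]
    by (auto simp: linear_on_def)
  moreover have "continuous_map T T (restrict f E)"
    using cont by (rule continuous_map_eq) auto
  moreover have "restrict f E \<in> E \<rightarrow>\<^sub>E E"
    using cont by (auto simp: continuous_map_def)
  ultimately show ?thesis by (simp add: cl_ops_def)
qed

text \<open>
  The weight \<open>n \<mapsto> v\<^bsub>K(n)\<^esub>(n)\<close> is eventually below every \<open>v\<^sub>k\<close>, so \<open>E\<^sub>\<alpha>\<close> embeds continuously in the
  corresponding space of null sequences, and bounded sets stay bounded there.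
\<close>

lemma bounded_in_diagonal_weight:
  assumes K: "filterlim K at_top sequentially" and B: "bounded_in T B"
  obtains M where "B \<subseteq> weighted_ball (\<lambda>n. v (K n) n) M"
proof -
  define w where "w = (\<lambda>n. v (K n) n)"
  have w: "0 < w n" for n by (simp add: w_def weight_pos)
  interpret Metric_space "c0 w" "\<lambda>x y. c0_norm w (x - y)"
    by (rule Metric_space_c0) (rule w)
  have "continuous_map (c0_topology (v k)) (c0_topology w) (\<lambda>x. x)" for k
  proof -
    have "eventually (\<lambda>n. k \<le> K n) sequentially"
      using K by (simp add: filterlim_at_top)
    then obtain N where N: "\<And>n. N \<le> n \<Longrightarrow> k \<le> K n"
      unfolding eventually_sequentially by blast
    \<comment> \<open>The finitely many indices below \<open>N\<close> are absorbed by a constant.\<close>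
    define c where "c = 1 + (\<Sum>n<N. w n / v k n)"
    have c: "1 \<le> c"
      unfolding c_def using w weight_pos by (simp add: sum_nonneg less_imp_le)
    have le: "w n \<le> c * v k n" for n
    proof (cases "n < N")
      case True
      have "w n / v k n \<le> (\<Sum>n<N. w n / v k n)"
        using True w weight_pos by (intro member_le_sum) (auto simp: less_imp_le)
      then have "w n / v k n \<le> c" by (simp add: c_def)
      then show ?thesis using weight_pos[of k n] by (simp add: field_simps)
    next
      case False
      then have "w n \<le> v k n" using N by (simp add: w_def weight_step_mono)
      also have "\<dots> \<le> c * v k n" using c weight_pos[of k n] by simp
      finally show ?thesis .
    qed
    have le': "w n * norm (x n) \<le> c * (v k n * norm (x n))" for x :: cseq and n
      using mult_right_mono[OF le[of n] norm_ge_zero[of "x n"]] by (simp add: mult.assoc)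
    show ?thesis
    proof (rule continuous_map_c0[where c = c])
      show "(\<lambda>x. x) ` c0 (v k) \<subseteq> c0 w"
      proof clarify
        fix x assume "x \<in> c0 (v k)"
        then have "(\<lambda>n. c * (v k n * norm (x n))) \<longlonglongrightarrow> c * 0"
          unfolding c0_def by (intro tendsto_mult tendsto_const) auto
        then have lim: "(\<lambda>n. c * (v k n * norm (x n))) \<longlonglongrightarrow> 0" by simp
        have "(\<lambda>n. w n * norm (x n)) \<longlonglongrightarrow> 0"
          by (rule tendsto_sandwich[OF _ _ tendsto_const lim])
             (use le' w in \<open>auto simp: less_imp_le\<close>)
        then show "x \<in> c0 w" by (simp add: c0_def)
      qed
      fix r
      show "(\<lambda>x. x) ` weighted_ball (v k) r \<subseteq> weighted_ball w (c * r)"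
      proof clarify
        fix x assume x: "x \<in> weighted_ball (v k) r"
        show "x \<in> weighted_ball w (c * r)"
        proof (rule weighted_ballI)
          fix n
          have "c * (v k n * norm (x n)) \<le> c * r"
            using c weighted_ballD[OF x] by (intro mult_left_mono) auto
          with le'[of n x] show "w n * norm (x n) \<le> c * r" by linarith
        qed
      qed
    qed (use w weight_pos c in \<open>auto simp: linear_on_def\<close>)
  qed
  then have cont: "continuous_map T mtopology (\<lambda>x. x)"
    using lcHs_c0_topology[of w] w
    by (intro continuous_map_from_ind_lim[OF ind_lim_T]) (auto simp: linear_on_def c0_topology_def)
  let ?U = "{x \<in> E. x \<in> mball 0 1}"
  have zero: "0 \<in> c0 w" by (simp add: c0_def)
  have "openin T ?U" using cont openin_mball unfolding continuous_map_def by blast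
  moreover have "0 \<in> ?U"
    using zero cseq.subspace_0[OF subspace_E] mdist_zero by (simp add: in_mball)
  ultimately obtain r :: real where r: "0 < r" "\<And>t::real. r < t \<Longrightarrow> B \<subseteq> (\<lambda>x. of_real t *\<^sub>c x) ` ?U"
    using B unfolding bounded_in_def by blast
  have "B \<subseteq> weighted_ball w (r + 1)"
  proof
    fix x assume "x \<in> B"
    with r(2)[of "r + 1"] obtain u where u: "u \<in> ?U" "x = of_real (r + 1) *\<^sub>c u" by auto
    have u': "u \<in> c0 w" "c0_norm w u \<le> 1"
      using u(1) zero commute[of 0 u] by (auto simp: in_mball)
    show "x \<in> weighted_ball w (r + 1)"
    proof (rule weighted_ballI)
      fix n
      have "w n * norm (x n) = (r + 1) * (w n * norm (u n))"
        using r(1) unfolding u(2) cscale_apply norm_mult norm_of_real by simp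
      also have "\<dots> \<le> (r + 1) * 1"
        using c0_norm_upper[OF u'(1), of n] u'(2) r(1) by (intro mult_left_mono) auto
      finally show "w n * norm (x n) \<le> r + 1" by simp
    qed
  qed
  then show thesis using that unfolding w_def by blast
qed

text \<open>
  If \<open>B\<close> is unbounded for every step, then, since entries at a fixed index stay bounded on \<open>B\<close>,
  the excess occurs at arbitrarily large indices. Choosing indices \<open>h(0) < h(1) < \<dots>\<close> with excess
  for \<open>v\<^sub>k\<close> at \<open>h(k)\<close> and a \<open>K\<close> with \<open>K(h(k)) = k\<close> contradicts the bound for the diagonal weight.
\<close>

lemma bounded_in_step:
  assumes B: "bounded_in T B"
  obtains k M where "B \<subseteq> weighted_ball (v k) M"
proof (rule ccontr)
  assume "\<not> thesis"
  then have "\<not> B \<subseteq> weighted_ball (v k) M" for k M using that by metis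
  then have unb: "\<exists>x\<in>B. \<exists>n. M < v k n * norm (x n)" for k M
    unfolding weighted_ball_def subset_iff mem_Collect_eq not_all not_imp not_le by metis
  obtain M0 where M0: "B \<subseteq> weighted_ball (\<lambda>n. v n n) M0"
    using bounded_in_diagonal_weight[OF filterlim_ident B] .
  have coord: "norm (x n) \<le> \<bar>M0\<bar> / v n n" if "x \<in> B" for x n
  proof -
    have "v n n * norm (x n) \<le> M0" using M0 that weighted_ballD by blast
    then show ?thesis using weight_pos[of n n] by (simp add: field_simps)
  qed
  let ?P = "\<lambda>k n. \<exists>x\<in>B. real k < v k n * norm (x n)"
  have late: "\<exists>n>N. ?P k n" for k N
  proof -
    let ?M = "real k + (\<Sum>n\<le>N. \<bar>M0\<bar> / v n n)"
    have nn: "0 \<le> \<bar>M0\<bar> / v n n" for n using weight_pos[of n n] by simp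
    obtain x n where x: "x \<in> B" "?M < v k n * norm (x n)" using unb by blast
    have "N < n"
    proof (rule ccontr)
      assume "\<not> N < n"
      have "v k n * norm (x n) \<le> 1 * norm (x n)"
        by (intro mult_right_mono weight_le_1) auto
      also have "\<dots> \<le> \<bar>M0\<bar> / v n n" using coord[OF x(1)] by simp
      also have "\<dots> \<le> (\<Sum>n\<le>N. \<bar>M0\<bar> / v n n)"
        using \<open>\<not> N < n\<close> nn by (intro member_le_sum) auto
      also have "\<dots> \<le> ?M" by simp
      finally show False using x(2) by simp
    qed
    moreover have "real k \<le> ?M" using nn by (simp add: sum_nonneg)
    ultimately show ?thesis using x by (meson le_less_trans)
  qed
  have "\<exists>h. \<forall>k. ?P k (h k) \<and> h k < h (Suc k)"
    by (rule dependent_nat_choice) (use late in blast)+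
  then obtain h where h: "\<And>k. ?P k (h k)" "\<And>k. h k < h (Suc k)" by blast
  then have mono: "strict_mono h" by (simp add: strict_mono_Suc_iff)
  define K where "K n = (LEAST k. n \<le> h k)" for n
  have Kh: "K (h k) = k" for k
    unfolding K_def using mono by (intro Least_equality) (auto simp: strict_mono_less_eq)
  have mono_K: "mono K"
  proof (rule monoI)
    fix m n :: nat assume "m \<le> n"
    moreover have "n \<le> h (K n)"
      unfolding K_def by (rule LeastI[of _ n]) (rule seq_suble[OF mono])
    ultimately show "K m \<le> K n" unfolding K_def[of m] by (intro Least_le) simp
  qed
  have "filterlim K at_top sequentially"
    unfolding filterlim_at_top eventually_sequentially using Kh mono_K by (metis monoD)
  from bounded_in_diagonal_weight[OF this B]
  obtain M where M: "B \<subseteq> weighted_ball (\<lambda>n. v (K n) n) M" .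
  obtain k where k: "M < real k" using reals_Archimedean2 by blast
  obtain x where x: "x \<in> B" "real k < v k (h k) * norm (x (h k))" using h(1) by blast
  have "v (K (h k)) (h k) * norm (x (h k)) \<le> M" using M x(1) weighted_ballD by blast
  then show False using x(2) k by (simp add: Kh)
qed

section \<open>Convergence of the iterates\<close>

text \<open>
  The index \<open>N\<close> splits the entries: beyond it the quotient of consecutive weights beats the bound
  \<open>2 M\<close> on \<open>C\<^sup>m x - P x\<close>, and up to it the geometric decay does, with constants depending only on
  \<open>k\<close>, \<open>M\<close> and \<open>N\<close>.
\<close>

lemma cesaro_powers_uniform:
  assumes e: "0 < \<epsilon>"
  shows "\<exists>m0. \<forall>m\<ge>m0. \<forall>x\<in>weighted_ball (v k) M.
    (cesaro ^^ m) x - const_first x \<in> weighted_ball (v (Suc k)) \<epsilon>"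
proof -
  have "(\<lambda>n. v (Suc k) n / v k n * (2 * M)) \<longlonglongrightarrow> 0"
    by (rule tendsto_mult_left_zero[OF weight_ratio_null])
  from order_tendstoD(2)[OF this e]
  obtain N where N: "\<And>n. N \<le> n \<Longrightarrow> v (Suc k) n / v k n * (2 * M) \<le> \<epsilon>"
    unfolding eventually_sequentially by (meson less_imp_le)
  let ?D = "2 * M / v k N"
  let ?q = "real N / real (Suc N)"
  have "(\<lambda>m. ?q ^ m * ?D) \<longlonglongrightarrow> 0"
    by (intro tendsto_mult_left_zero LIMSEQ_realpow_zero) auto
  from order_tendstoD(2)[OF this e]
  obtain m0 where m0: "\<And>m. m0 \<le> m \<Longrightarrow> ?q ^ m * ?D \<le> \<epsilon>"
    unfolding eventually_sequentially by (meson less_imp_le)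
  have "(cesaro ^^ m) x - const_first x \<in> weighted_ball (v (Suc k)) \<epsilon>"
    if m: "m0 \<le> m" and x: "x \<in> weighted_ball (v k) M" for m x
  proof (rule weighted_ballI)
    fix n
    let ?z = "x - const_first x"
    let ?y = "(cesaro ^^ m) x - const_first x"
    have y: "?y = (cesaro ^^ m) ?z" by (rule cesaro_power_diff)
    have Px: "const_first x \<in> weighted_ball (v k) M"
      by (rule const_first_weighted_ball[OF weight_decseq x])
    have z: "?z \<in> weighted_ball (v k) (2 * M)"
    proof (rule weighted_ballI)
      fix i
      have "v k i * norm (?z i) \<le> v k i * (norm (x i) + norm (const_first x i))"
        using weight_pos[of k i] norm_triangle_ineq4[of "x i" "const_first x i"]
        by (intro mult_left_mono) auto
      also have "\<dots> \<le> 2 * M"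
        using weighted_ballD[OF x, of i] weighted_ballD[OF Px, of i] by (simp add: distrib_left)
      finally show "v k i * norm (?z i) \<le> 2 * M" .
    qed
    show "v (Suc k) n * norm (?y n) \<le> \<epsilon>"
    proof (cases "n \<le> N")
      case True
      have "norm (?z i) \<le> ?D" if "i \<le> N" for i
      proof -
        have "v k N * norm (?z i) \<le> v k i * norm (?z i)"
          using weight_decseq[of k] that by (intro mult_right_mono) (auto simp: decseq_def)
        also have "\<dots> \<le> 2 * M" by (rule weighted_ballD[OF z])
        finally show ?thesis using weight_pos[of k N] by (simp add: field_simps)
      qed
      moreover have "?z 0 = 0" by (simp add: const_first_def)
      ultimately have "norm (?y n) \<le> ?q ^ m * ?D"
        unfolding y using True by (intro cesaro_power_decay)
      also have "\<dots> \<le> \<epsilon>" by (rule m0[OF m])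
      finally have "norm (?y n) \<le> \<epsilon>" .
      moreover have "v (Suc k) n * norm (?y n) \<le> 1 * norm (?y n)"
        by (intro mult_right_mono weight_le_1) auto
      ultimately show ?thesis by simp
    next
      case False
      have "(cesaro ^^ m) ?z \<in> weighted_ball (v k) (2 * M)"
        using weight_pos weight_decseq z by (rule cesaro_power_weighted_ball)
      then have "v k n * norm (?y n) \<le> 2 * M" unfolding y by (rule weighted_ballD)
      then have "v (Suc k) n / v k n * (v k n * norm (?y n)) \<le> v (Suc k) n / v k n * (2 * M)"
        using weight_pos by (intro mult_left_mono) (auto simp: less_imp_le)
      also have "\<dots> \<le> \<epsilon>" using False by (intro N) simp
      finally show ?thesis using weight_pos[of k n] by simp
    qed
  qed
  then show ?thesis by blast
qed

lemma cesaro_power_cl_ops: "restrict (cesaro ^^ m) E \<in> cl_ops T"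
  by (rule restrict_in_cl_ops)
     (auto simp: linear_cesaro_power weight_pos weight_decseq cesaro_power_weighted_ball)

lemma const_first_cl_ops: "restrict const_first E \<in> cl_ops T"
  by (rule restrict_in_cl_ops)
     (auto simp: linear_const_first weight_decseq const_first_weighted_ball)

lemma cesaro_powers_tendsto:
  "limitin (Lb_topology T) (\<lambda>m. restrict (cesaro ^^ m) E) (restrict const_first E) sequentially"
  unfolding limitin_def
proof (intro conjI allI impI)
  show "restrict const_first E \<in> topspace (Lb_topology T)"
    using topspace_Lb_topology cseq.subspace_0[OF subspace_E] const_first_cl_ops by blast
  fix W assume "openin (Lb_topology T) W \<and> restrict const_first E \<in> W"
  then obtain B U where B: "bounded_in T B" and U: "openin T U" "0 \<in> U"
    and W: "{g \<in> cl_ops T. \<forall>x\<in>B. g x - restrict const_first E x \<in> U} \<subseteq> W"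
    unfolding openin_Lb_topology Lb_open_def by blast
  obtain k M where k: "B \<subseteq> weighted_ball (v k) M" using bounded_in_step[OF B] .
  have "0 \<in> c0 (v (Suc k))" by (simp add: c0_def)
  from neighbourhood_contains_ball[OF U this] obtain \<epsilon> where e: "0 < \<epsilon>"
    "\<And>y. y \<in> c0 (v (Suc k)) \<Longrightarrow> y \<in> weighted_ball (v (Suc k)) \<epsilon> \<Longrightarrow> y \<in> U"
    by (metis diff_zero)
  obtain m0 where m0: "\<And>m x. m0 \<le> m \<Longrightarrow> x \<in> weighted_ball (v k) M \<Longrightarrow>
      (cesaro ^^ m) x - const_first x \<in> weighted_ball (v (Suc k)) \<epsilon>"
    using cesaro_powers_uniform[OF e(1)] by blast
  have "restrict (cesaro ^^ m) E \<in> W" if m: "m0 \<le> m" for m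
  proof -
    have "restrict (cesaro ^^ m) E x - restrict const_first E x \<in> U" if "x \<in> B" for x
    proof -
      have x: "x \<in> weighted_ball (v k) M" using k that by blast
      have "(cesaro ^^ m) x \<in> c0 (v (Suc k))" "const_first x \<in> c0 (v (Suc k))"
        using cesaro_power_weighted_ball[OF weight_pos weight_decseq x]
          const_first_weighted_ball[OF weight_decseq x] ball_subset_next_c0 by blast+
      then have "(cesaro ^^ m) x - const_first x \<in> c0 (v (Suc k))"
        using step_diff by blast
      from e(2)[OF this m0[OF m x]] show ?thesis
        using x E_iff_ball by auto
    qed
    then show ?thesis using W cesaro_power_cl_ops by blast
  qed
  then show "\<forall>\<^sub>F m in sequentially. restrict (cesaro ^^ m) E \<in> W"
    unfolding eventually_sequentially by blast
qed

text \<open>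
  An \<open>x\<close> with \<open>x\<^sub>0 = 0\<close> is approximated by \<open>x - C\<^sup>m x\<close> in the step following one where it is bounded.
\<close>

lemma kernel_const_first:
  "{x \<in> E. const_first x = 0} = T closure_of ((\<lambda>x. x - cesaro x) ` E)" (is "?N = T closure_of ?R")
proof
  have inv: "cesaro x \<in> E" if "x \<in> E" for x
    using that cesaro_weighted_ball[OF weight_pos weight_decseq] unfolding E_iff_ball by blast
  show "?N \<subseteq> T closure_of ?R"
  proof
    fix x assume "x \<in> ?N"
    then have x: "x \<in> E" and Px: "const_first x = 0" by auto
    then obtain k M where xk: "x \<in> weighted_ball (v k) M" unfolding E_iff_ball by blast
    then have xc: "x \<in> c0 (v (Suc k))" using ball_subset_next_c0 by blast
    have "\<exists>y. y \<in> ?R \<and> y \<in> U" if U: "openin T U" "x \<in> U" for U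
    proof -
      obtain \<epsilon> where e: "0 < \<epsilon>"
        "\<And>y. y \<in> c0 (v (Suc k)) \<Longrightarrow> y - x \<in> weighted_ball (v (Suc k)) \<epsilon> \<Longrightarrow> y \<in> U"
        using neighbourhood_contains_ball[OF U xc] by blast
      obtain m where "(cesaro ^^ m) x - const_first x \<in> weighted_ball (v (Suc k)) \<epsilon>"
        using cesaro_powers_uniform[OF e(1)] xk by blast
      then have "(x - (cesaro ^^ m) x) - x \<in> weighted_ball (v (Suc k)) \<epsilon>"
        by (simp add: Px weighted_ball_def)
      moreover have "(cesaro ^^ m) x \<in> c0 (v (Suc k))"
        using cesaro_power_weighted_ball[OF weight_pos weight_decseq xk] ball_subset_next_c0 by blast
      then have "x - (cesaro ^^ m) x \<in> c0 (v (Suc k))"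
        using xc step_diff by blast
      ultimately have "x - (cesaro ^^ m) x \<in> U" using e(2) by blast
      then show ?thesis using cesaro_power_telescope[OF subspace_E inv x] by blast
    qed
    then show "x \<in> T closure_of ?R" using x by (simp add: in_closure_of)
  qed
  show "T closure_of ?R \<subseteq> ?N"
  proof (rule closure_of_minimal)
    show "?R \<subseteq> ?N"
    proof clarify
      fix x assume x: "x \<in> E"
      have "x - cesaro x \<in> E" using x inv cseq.subspace_diff[OF subspace_E] by blast
      moreover have "const_first (x - cesaro x) = 0"
        by (simp add: const_first_def cesaro_def fun_eq_iff)
      ultimately show "x - cesaro x \<in> E \<and> const_first (x - cesaro x) = 0" by blast
    qed
    have "closedin T {0}"
      using lcHs_T cseq.subspace_0[OF subspace_E] by (simp add: lcHs_def closedin_Hausdorff_singleton)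
    with const_first_cl_ops have "closedin T {x \<in> E. restrict const_first E x \<in> {0}}"
      unfolding cl_ops_def by (blast intro: closedin_continuous_map_preimage)
    moreover have "{x \<in> E. restrict const_first E x \<in> {0}} = ?N" by auto
    ultimately show "closedin T ?N" by simp
  qed
qed

lemma const_first_is_projection:
  "is_projection_along E (restrict const_first E) (cseq_span {1})
    (T closure_of ((\<lambda>x. x - cesaro x) ` E))"
  unfolding is_projection_along_def
proof (intro conjI ballI)
  show P: "restrict const_first E \<in> E \<rightarrow>\<^sub>E E" and "linear_on E (restrict const_first E)"
    using const_first_cl_ops by (auto simp: cl_ops_def)
  have PE: "const_first x \<in> E" if "x \<in> E" for x
    using P that by auto
  show "restrict const_first E (restrict const_first E x) = restrict const_first E x" if "x \<in> E" for x
    using that PE by (simp add: const_first_def)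
  have "(1 :: cseq) \<in> weighted_ball (v 0) 1"
    using weight_le_1 by (auto intro!: weighted_ballI)
  then have one: "1 \<in> E" using E_iff_ball by blast
  show "restrict const_first E ` E = cseq_span {1}"
    unfolding cseq.span_singleton
  proof (intro equalityI subsetI)
    fix y assume "y \<in> restrict const_first E ` E"
    then obtain x :: cseq where "y = x 0 *\<^sub>c 1" by (auto simp: const_first_def fun_eq_iff)
    then show "y \<in> range (\<lambda>c. c *\<^sub>c 1)" by blast
  next
    fix y :: cseq assume "y \<in> range (\<lambda>c. c *\<^sub>c 1)"
    then obtain c where y: "y = c *\<^sub>c 1" by blast
    then have "y \<in> E" using one cseq.subspace_scale[OF subspace_E] by blast
    moreover have "const_first y = y" by (simp add: y const_first_def fun_eq_iff)
    ultimately show "y \<in> restrict const_first E ` E" by (auto intro!: image_eqI[of _ _ y])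
  qed
  show "{x \<in> E. restrict const_first E x = 0} = T closure_of ((\<lambda>x. x - cesaro x) ` E)"
    unfolding kernel_const_first[symmetric] by (rule Collect_cong) auto
qed

end

theorem proposition4p2:
  fixes \<alpha> s :: "nat \<Rightarrow> real"
  assumes "\<And>n. 0 < \<alpha> n" and "strict_mono \<alpha>" and "filterlim \<alpha> at_top sequentially"
    and "\<And>k. 1 < s k" and "strict_mono s" and "filterlim s at_top sequentially"
  defines "T \<equiv> E_topology \<alpha> s"
  defines "E \<equiv> topspace T"
  shows "\<exists>P. is_projection_along E P (cseq_span {1}) (T closure_of ((\<lambda>x. x - cesaro x) ` E)) \<and>
    limitin (Lb_topology T) (\<lambda>m. restrict (cesaro ^^ m) E) P sequentially"
proof -
  interpret power_weights \<alpha> s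
    using assms(1-5) by unfold_locales auto
  show ?thesis
    unfolding E_def T_def using const_first_is_projection cesaro_powers_tendsto by blast
qed

end
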